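(* Each spectral space is homeomorphic to the spectrum $\operatorname{Spec}(R)$, endowed with the Zariski topology, of some commutative ring $R$.
   Context: A topological space is spectral if (i) its quasicompact open sets are stable under finite intersections (including the empty intersection, so the space is quasicompact) and form a basis of the topology, and (ii) each irreducible closed set has exactly one generic point. Rings are commutative with unit. *)

theory Defs
  imports "HOL-Analysis.Abstract_Topology" "HOL-Algebra.Ideal"
begin

definition quasicompact_open :: "'a topology \<Rightarrow> 'a set \<Rightarrow> bool" where
  "quasicompact_open X U \<longleftrightarrow> openin X U \<and> compactin X U"

(* The empty set does not count as irreducible, so the empty space is spectral;
   it is the spectrum of the zero ring. *)
definition irreducible_closedin :: "'a topology \<Rightarrow> 'a set \<Rightarrow> bool" where
  "irreducible_closedin X Z \<longleftrightarrow>
     closedin X Z \<and> Z \<noteq> {} \<and>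
     (\<forall>A B. closedin X A \<and> closedin X B \<and> Z = A \<union> B \<longrightarrow> Z = A \<or> Z = B)"

definition generic_point :: "'a topology \<Rightarrow> 'a set \<Rightarrow> 'a \<Rightarrow> bool" where
  "generic_point X Z x \<longleftrightarrow> x \<in> topspace X \<and> X closure_of {x} = Z"

(* Intersecting with topspace X makes the empty intersection equal to the whole space. *)
definition spectral_space :: "'a topology \<Rightarrow> bool" where
  "spectral_space X \<longleftrightarrow>
     (\<forall>\<F>. finite \<F> \<and> (\<forall>U\<in>\<F>. quasicompact_open X U) \<longrightarrow>
          quasicompact_open X (topspace X \<inter> \<Inter>\<F>)) \<and>
     openin X = arbitrary union_of quasicompact_open X \<and>
     (\<forall>Z. irreducible_closedin X Z \<longrightarrow> (\<exists>!x. generic_point X Z x))"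

definition prime_spectrum :: "('a, 'b) ring_scheme \<Rightarrow> 'a set set" where
  "prime_spectrum R = {P. primeideal P R}"

definition zariski_closed :: "('a, 'b) ring_scheme \<Rightarrow> 'a set \<Rightarrow> 'a set set" where
  "zariski_closed R S = {P \<in> prime_spectrum R. S \<subseteq> P}"

definition Spec :: "('a, 'b) ring_scheme \<Rightarrow> 'a set topology" where
  "Spec R = topology (\<lambda>U. \<exists>S \<subseteq> carrier R. U = prime_spectrum R - zariski_closed R S)"

lemma istopology_zariski:
  "istopology (\<lambda>U. \<exists>S \<subseteq> carrier R. U = prime_spectrum R - zariski_closed R S)"
  unfolding istopology_def
proof (intro conjI allI impI)
  fix U V
  assume "\<exists>S \<subseteq> carrier R. U = prime_spectrum R - zariski_closed R S"
    and "\<exists>S \<subseteq> carrier R. V = prime_spectrum R - zariski_closed R S"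
  then obtain S T where S: "S \<subseteq> carrier R" "U = prime_spectrum R - zariski_closed R S"
    and T: "T \<subseteq> carrier R" "V = prime_spectrum R - zariski_closed R T" by blast
  show "\<exists>W \<subseteq> carrier R. U \<inter> V = prime_spectrum R - zariski_closed R W"
  proof (cases "prime_spectrum R = {}")
    case True
    then show ?thesis using S T by blast
  next
    case False
    then obtain Q where "primeideal Q R" by (auto simp: prime_spectrum_def)
    then interpret R: cring R by (simp add: primeideal_def)
    let ?W = "{s \<otimes>\<^bsub>R\<^esub> t | s t. s \<in> S \<and> t \<in> T}"
    have "?W \<subseteq> P \<longleftrightarrow> S \<subseteq> P \<or> T \<subseteq> P" if P: "P \<in> prime_spectrum R" for P
    proof -
      interpret P: primeideal P R using P by (simp add: prime_spectrum_def)
      show ?thesis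
      proof
        assume W: "?W \<subseteq> P"
        show "S \<subseteq> P \<or> T \<subseteq> P"
        proof (rule ccontr)
          assume "\<not> (S \<subseteq> P \<or> T \<subseteq> P)"
          then obtain s t where "s \<in> S" "s \<notin> P" "t \<in> T" "t \<notin> P" by blast
          then show False using W S(1) T(1) P.I_prime[of s t] by blast
        qed
      next
        assume "S \<subseteq> P \<or> T \<subseteq> P"
        then show "?W \<subseteq> P" using S(1) T(1) P.I_l_closed P.I_r_closed by blast
      qed
    qed
    then have "U \<inter> V = prime_spectrum R - zariski_closed R ?W"
      unfolding S(2) T(2) zariski_closed_def by blast
    moreover have "?W \<subseteq> carrier R" using S(1) T(1) by blast
    ultimately show ?thesis by blast
  qed
next
  fix \<K>
  assume "\<forall>U\<in>\<K>. \<exists>S \<subseteq> carrier R. U = prime_spectrum R - zariski_closed R S"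
  then obtain f where f: "\<And>U. U \<in> \<K> \<Longrightarrow> f U \<subseteq> carrier R"
      "\<And>U. U \<in> \<K> \<Longrightarrow> U = prime_spectrum R - zariski_closed R (f U)" by metis
  have "\<Union>\<K> = (\<Union>U\<in>\<K>. prime_spectrum R - zariski_closed R (f U))" using f(2) by auto
  also have "\<dots> = prime_spectrum R - zariski_closed R (\<Union>U\<in>\<K>. f U)"
    by (auto simp: zariski_closed_def)
  finally show "\<exists>S \<subseteq> carrier R. \<Union>\<K> = prime_spectrum R - zariski_closed R S"
    using f(1) by (intro exI[of _ "\<Union>U\<in>\<K>. f U"]) blast
qed

lemma openin_Spec:
  "openin (Spec R) U \<longleftrightarrow> (\<exists>S \<subseteq> carrier R. U = prime_spectrum R - zariski_closed R S)"
  unfolding Spec_def by (simp add: topology_inverse'[OF istopology_zariski])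

lemma topspace_Spec: "topspace (Spec R) = prime_spectrum R"
proof
  show "topspace (Spec R) \<subseteq> prime_spectrum R"
    using openin_topspace[of "Spec R"] unfolding openin_Spec by blast
  have "\<not> carrier R \<subseteq> P" if "P \<in> prime_spectrum R" for P
  proof -
    interpret P: primeideal P R using that by (simp add: prime_spectrum_def)
    show ?thesis using P.I_notcarr P.a_subset by blast
  qed
  then have "zariski_closed R (carrier R) = {}" by (auto simp: zariski_closed_def)
  then have "openin (Spec R) (prime_spectrum R)" unfolding openin_Spec by (metis Diff_empty order_refl)
  then show "prime_spectrum R \<subseteq> topspace (Spec R)" by (rule openin_subset)
qed

(* A ring cannot be existentially quantified together with the type of its elements.
   This type has room for the rings needed for spaces on 'a: it is infinite, and a space with n
   quasicompact open sets is the spectrum of a ring with at most max(aleph_0, n) elements,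
   where n is at most the cardinality of 'a set. *)
type_synonym 'a ring_elem = "('a set + nat) set set"

end

theory Submission
  imports Defs "HOL-Library.Poly_Mapping" "HOL-Library.Equipollence"
    "HOL-Computational_Algebra.Fraction_Field" "HOL-Algebra.Weak_Morphisms"
begin

text \<open>
  Take an indeterminate \<open>T U\<close> for every quasicompact open set \<open>U\<close> and let \<open>K\<close> be the field of
  rational functions in all of them. For a point \<open>y\<close>, let \<open>v y\<close> be the order of vanishing in the
  indeterminates \<open>T U\<close> with \<open>y \<notin> U\<close>; it is trivial on the subfield \<open>K y\<close> generated by the
  remaining ones. The ring consists of the \<open>K\<close>-valued functions \<open>f\<close> with finitely many values and
  constructible fibres such that \<open>f y \<in> K y\<close>, and \<open>v y (f x - f y) > 0\<close> whenever \<open>x\<close> specializes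
  to \<open>y\<close>. The last condition makes the set \<open>D f\<close> where \<open>f\<close> is nonzero stable under generization,
  hence quasicompact open, and the function equal to \<open>T U\<close> on \<open>U\<close> and to \<open>0\<close> elsewhere belongs to
  the ring, so every quasicompact open set is some \<open>D f\<close>.

  If \<open>D f \<subseteq> D g\<close>, then \<open>f ^ n / g\<close>, extended by zero, belongs to the ring for large \<open>n\<close>, because
  the orders \<open>v y (g x)\<close> are bounded: \<open>g\<close> has finitely many values, and the order of an element
  of \<open>K\<close> is at most the degree of its numerator. Moreover \<open>D (f + c g) = D f \<union> D g\<close> for a
  suitable integer \<open>c\<close>. Hence a prime ideal is determined by the sets \<open>D f\<close> of its members, the
  complement of their union is irreducible and closed, and its generic point \<open>x\<close> satisfies
  \<open>f \<in> P \<longleftrightarrow> f x = 0\<close>.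
\<close>

section \<open>Orders of vanishing of rational functions\<close>

definition weighted_degree :: "'v set \<Rightarrow> ('v \<Rightarrow>\<^sub>0 nat) \<Rightarrow> nat" where
  "weighted_degree S m = (\<Sum>v\<in>Poly_Mapping.keys m \<inter> S. Poly_Mapping.lookup m v)"

lemma weighted_degree_superset:
  assumes "finite A" "Poly_Mapping.keys m \<subseteq> A"
  shows "weighted_degree S m = (\<Sum>v\<in>A \<inter> S. Poly_Mapping.lookup m v)"
  unfolding weighted_degree_def
  by (rule sum.mono_neutral_left) (use assms in \<open>auto simp: in_keys_iff\<close>)

lemma weighted_degree_add: "weighted_degree S (m + n) = weighted_degree S m + weighted_degree S n"
proof -
  have "Poly_Mapping.keys (m + n) \<subseteq> Poly_Mapping.keys m \<union> Poly_Mapping.keys n" by (rule keys_add)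
  then show ?thesis
    by (simp add: weighted_degree_superset[of "Poly_Mapping.keys m \<union> Poly_Mapping.keys n"] lookup_add sum.distrib)
qed

lemma weighted_degree_zero [simp]: "weighted_degree S 0 = 0"
  by (simp add: weighted_degree_def)

lemma weighted_degree_single [simp]:
  "weighted_degree S (Poly_Mapping.single v (Suc 0)) = (if v \<in> S then 1 else 0)"
  by (simp add: weighted_degree_def)

lemma weighted_degree_le: "weighted_degree S m \<le> weighted_degree UNIV m"
  unfolding weighted_degree_def by (rule sum_mono2) auto

text \<open>At \<open>p = 0\<close> this is the \<open>Min\<close> of an empty set, an unspecified
  number; zero is therefore treated apart wherever orders are compared.\<close>

definition vanishing_order :: "'v set \<Rightarrow> (('v \<Rightarrow>\<^sub>0 nat) \<Rightarrow>\<^sub>0 int) \<Rightarrow> nat" where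
  "vanishing_order S p = Min (weighted_degree S ` Poly_Mapping.keys p)"

lemma vanishing_order_le: "m \<in> Poly_Mapping.keys p \<Longrightarrow> vanishing_order S p \<le> weighted_degree S m"
  by (simp add: vanishing_order_def)

lemma vanishing_order_attained:
  assumes "p \<noteq> 0"
  obtains m where "m \<in> Poly_Mapping.keys p" "weighted_degree S m = vanishing_order S p"
proof -
  have "vanishing_order S p \<in> weighted_degree S ` Poly_Mapping.keys p"
    unfolding vanishing_order_def using assms by (intro Min_in) auto
  then show ?thesis using that by auto
qed

lemma vanishing_order_geI:
  assumes "p \<noteq> 0" "\<And>m. m \<in> Poly_Mapping.keys p \<Longrightarrow> n \<le> weighted_degree S m"
  shows "n \<le> vanishing_order S p"
  by (metis assms vanishing_order_attained)

lemma vanishing_order_uminus [simp]: "vanishing_order S (- p) = vanishing_order S p"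
  by (simp add: vanishing_order_def)

lemma vanishing_order_add:
  assumes "p + q \<noteq> 0" "p = 0 \<or> n \<le> vanishing_order S p" "q = 0 \<or> n \<le> vanishing_order S q"
  shows "n \<le> vanishing_order S (p + q)"
proof (rule vanishing_order_geI[OF assms(1)])
  fix m assume "m \<in> Poly_Mapping.keys (p + q)"
  then have "m \<in> Poly_Mapping.keys p \<or> m \<in> Poly_Mapping.keys q" using keys_add[of p q] by auto
  then show "n \<le> weighted_degree S m"
    using assms(2,3) vanishing_order_le[of m p S] vanishing_order_le[of m q S] by auto
qed

lemma weighted_degree_keys_mult:
  assumes "m \<in> Poly_Mapping.keys (p * q)"
  obtains a b where "a \<in> Poly_Mapping.keys p" "b \<in> Poly_Mapping.keys q" "weighted_degree S m = weighted_degree S a + weighted_degree S b"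
  using assms keys_mult[of p q] by (auto simp: weighted_degree_add)

lemma initial_form:
  fixes p :: "('v \<Rightarrow>\<^sub>0 nat) \<Rightarrow>\<^sub>0 int"
  assumes "p \<noteq> 0"
  obtains p0 p1 where "p = p0 + p1" "p0 \<noteq> 0"
    "\<And>m. m \<in> Poly_Mapping.keys p0 \<Longrightarrow> weighted_degree S m = vanishing_order S p"
    "\<And>m. m \<in> Poly_Mapping.keys p1 \<Longrightarrow> weighted_degree S m > vanishing_order S p"
proof -
  let ?n = "vanishing_order S p"
  \<comment> \<open>A polynomial over the integers is a formal integer combination of monomials, so
    \<open>frag_split\<close> can separate its monomials by degree.\<close>
  have "Poly_Mapping.keys p \<subseteq> {m. weighted_degree S m = ?n} \<union> {m. weighted_degree S m > ?n}"
    using vanishing_order_le[of _ p S] by fastforce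
  then obtain p0 p1 where p: "Poly_Mapping.keys p0 \<subseteq> {m. weighted_degree S m = ?n}"
      "Poly_Mapping.keys p1 \<subseteq> {m. weighted_degree S m > ?n}" "p0 + p1 = p"
    by (rule frag_split)
  obtain m where m: "m \<in> Poly_Mapping.keys p" "weighted_degree S m = ?n"
    using vanishing_order_attained[OF assms] by blast
  have "p0 \<noteq> 0" using m p by auto
  then show ?thesis using p by (intro that[of p0 p1]) auto
qed

text \<open>The initial form of a product is the product of the initial forms.\<close>

lemma vanishing_order_mult:
  fixes p q :: "('v::linorder \<Rightarrow>\<^sub>0 nat) \<Rightarrow>\<^sub>0 int"
  assumes "p \<noteq> 0" "q \<noteq> 0"
  shows "vanishing_order S (p * q) = vanishing_order S p + vanishing_order S q"
proof (rule antisym)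
  let ?a = "vanishing_order S p" and ?b = "vanishing_order S q"
  show "?a + ?b \<le> vanishing_order S (p * q)"
  proof (rule vanishing_order_geI)
    show "p * q \<noteq> 0" using assms by simp
    fix m assume "m \<in> Poly_Mapping.keys (p * q)"
    then show "?a + ?b \<le> weighted_degree S m"
      by (rule weighted_degree_keys_mult[where S = S]) (simp add: vanishing_order_le add_mono)
  qed
  obtain p0 p1 where p: "p = p0 + p1" "p0 \<noteq> 0"
    "\<And>m. m \<in> Poly_Mapping.keys p0 \<Longrightarrow> weighted_degree S m = ?a"
    "\<And>m. m \<in> Poly_Mapping.keys p1 \<Longrightarrow> weighted_degree S m > ?a"
    using initial_form[OF assms(1)] by blast
  obtain q0 q1 where q: "q = q0 + q1" "q0 \<noteq> 0"
    "\<And>m. m \<in> Poly_Mapping.keys q0 \<Longrightarrow> weighted_degree S m = ?b"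
    "\<And>m. m \<in> Poly_Mapping.keys q1 \<Longrightarrow> weighted_degree S m > ?b"
    using initial_form[OF assms(2)] by blast
  have "p0 * q0 \<noteq> 0" using p q by simp
  then obtain m where m: "m \<in> Poly_Mapping.keys (p0 * q0)" by (metis all_not_in_conv keys_eq_empty)
  have deg: "weighted_degree S m = ?a + ?b"
    using m by (rule weighted_degree_keys_mult[where S = S]) (simp add: p q)
  \<comment> \<open>Every monomial of \<open>p1 * q\<close> and of \<open>p0 * q1\<close> has degree
    above \<open>?a + ?b\<close>, so nothing cancels the term at \<open>m\<close>.\<close>
  have "m \<notin> Poly_Mapping.keys (p1 * q)"
  proof
    assume "m \<in> Poly_Mapping.keys (p1 * q)"
    then obtain a b where "a \<in> Poly_Mapping.keys p1" "b \<in> Poly_Mapping.keys q" "weighted_degree S m = weighted_degree S a + weighted_degree S b"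
      by (rule weighted_degree_keys_mult)
    then show False using deg p(4)[of a] vanishing_order_le[of b q S] by simp
  qed
  moreover have "m \<notin> Poly_Mapping.keys (p0 * q1)"
  proof
    assume "m \<in> Poly_Mapping.keys (p0 * q1)"
    then obtain a b where "a \<in> Poly_Mapping.keys p0" "b \<in> Poly_Mapping.keys q1" "weighted_degree S m = weighted_degree S a + weighted_degree S b"
      by (rule weighted_degree_keys_mult)
    then show False using deg p(3)[of a] q(4)[of b] by simp
  qed
  moreover have "p * q = p0 * q0 + (p0 * q1 + p1 * q)" by (simp add: p(1) q(1) algebra_simps)
  ultimately have "Poly_Mapping.lookup (p * q) m = Poly_Mapping.lookup (p0 * q0) m"
    by (simp add: lookup_add in_keys_iff)
  then have "m \<in> Poly_Mapping.keys (p * q)" using m by (simp add: in_keys_iff)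
  then show "vanishing_order S (p * q) \<le> ?a + ?b" using vanishing_order_le deg by metis
qed

type_synonym 'v rational_function = "(('v \<Rightarrow>\<^sub>0 nat) \<Rightarrow>\<^sub>0 int) fract"

text \<open>\<open>val_ge S n a\<close> says that \<open>a\<close> vanishes to order at least \<open>n\<close> along \<open>S\<close>, where \<open>0\<close> has infinite order.\<close>

definition val_ge :: "'v::linorder set \<Rightarrow> int \<Rightarrow> 'v rational_function \<Rightarrow> bool" where
  "val_ge S n a \<longleftrightarrow> (\<exists>p q. q \<noteq> 0 \<and> a = Fract p q \<and>
     (p = 0 \<or> n + int (vanishing_order S q) \<le> int (vanishing_order S p)))"

lemma val_ge_zero [simp]: "val_ge S n 0"
  unfolding val_ge_def by (metis fract_collapse(1) one_neq_zero)

lemma val_ge_uminus: "val_ge S n a \<Longrightarrow> val_ge S n (- a)"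
  unfolding val_ge_def by (metis minus_fract neg_equal_0_iff_equal vanishing_order_uminus)

lemma val_ge_mono:
  assumes "val_ge S n a" "m \<le> n"
  shows "val_ge S m a"
proof -
  obtain p q where "q \<noteq> 0" "a = Fract p q"
    "p = 0 \<or> n + int (vanishing_order S q) \<le> int (vanishing_order S p)"
    using assms(1) unfolding val_ge_def by blast
  then show ?thesis unfolding val_ge_def using assms(2)
    by (intro exI[of _ p] exI[of _ q]) auto
qed

lemma val_ge_mult:
  assumes "val_ge S m a" "val_ge S n b"
  shows "val_ge S (m + n) (a * b)"
proof -
  obtain p q where a: "q \<noteq> 0" "a = Fract p q" "p = 0 \<or> m + int (vanishing_order S q) \<le> int (vanishing_order S p)"
    using assms(1) unfolding val_ge_def by blast
  obtain r s where b: "s \<noteq> 0" "b = Fract r s" "r = 0 \<or> n + int (vanishing_order S s) \<le> int (vanishing_order S r)"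
    using assms(2) unfolding val_ge_def by blast
  have "p * r = 0 \<or> m + n + int (vanishing_order S (q * s)) \<le> int (vanishing_order S (p * r))"
    using a b by (cases "p = 0"; cases "r = 0") (auto simp: vanishing_order_mult)
  then show ?thesis using a b unfolding val_ge_def
    by (intro exI[of _ "p * r"] exI[of _ "q * s"]) simp
qed

lemma val_ge_add:
  assumes "val_ge S n a" "val_ge S n b"
  shows "val_ge S n (a + b)"
proof -
  obtain p q where a: "q \<noteq> 0" "a = Fract p q" "p = 0 \<or> n + int (vanishing_order S q) \<le> int (vanishing_order S p)"
    using assms(1) unfolding val_ge_def by blast
  obtain r s where b: "s \<noteq> 0" "b = Fract r s" "r = 0 \<or> n + int (vanishing_order S s) \<le> int (vanishing_order S r)"
    using assms(2) unfolding val_ge_def by blast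
  have "n + int (vanishing_order S (q * s)) \<le> int (vanishing_order S (p * s + r * q))"
    if "p * s + r * q \<noteq> 0"
  proof -
    \<comment> \<open>The bound may be negative, whereas \<open>vanishing_order_add\<close> takes a
      natural number; orders are nonnegative, so truncation at 0 loses nothing.\<close>
    have "nat (n + int (vanishing_order S (q * s))) \<le> vanishing_order S (p * s + r * q)"
      using a b by (intro vanishing_order_add that; cases "p = 0"; cases "r = 0")
        (auto simp: vanishing_order_mult)
    then show ?thesis by linarith
  qed
  then show ?thesis using a b unfolding val_ge_def
    by (intro exI[of _ "p * s + r * q"] exI[of _ "q * s"]) auto
qed

lemma val_ge_power: "val_ge S 1 a \<Longrightarrow> val_ge S (int n) (a ^ n)"
proof (induction n)
  case 0
  show ?case unfolding val_ge_def
    by (intro exI[of _ 1]) (simp add: fract_collapse)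
next
  case (Suc n)
  then show ?case using val_ge_mult[of S 1 a "int n" "a ^ n"] by simp
qed

text \<open>With \<open>a = p / q\<close>, the order of \<open>q\<close> is below that of
  \<open>p\<close>. Hence \<open>q + p\<close> is nonzero, and its order is at most that of
  \<open>q\<close>, since otherwise \<open>q = (q + p) - p\<close> would have order greater than its
  own.\<close>

lemma val_ge_inverse_one_plus:
  assumes "val_ge S 1 a"
  shows "1 + a \<noteq> 0" "val_ge S 0 (inverse (1 + a))"
proof -
  obtain p q where a: "q \<noteq> 0" "a = Fract p q" "p = 0 \<or> 1 + int (vanishing_order S q) \<le> int (vanishing_order S p)"
    using assms(1) unfolding val_ge_def by blast
  have ne: "q + p \<noteq> 0"
  proof
    assume "q + p = 0"
    then have "p = - q" by (simp add: eq_neg_iff_add_eq_0 add.commute)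
    then show False using a by simp
  qed
  have eq: "1 + a = Fract (q + p) q" using a by (simp add: One_fract_def add.commute)
  show "1 + a \<noteq> 0" unfolding eq using ne a by (simp add: Zero_fract_def eq_fract)
  have "vanishing_order S (q + p) \<le> vanishing_order S q"
  proof (rule ccontr)
    assume "\<not> ?thesis"
    then have "Suc (vanishing_order S q) \<le> vanishing_order S ((q + p) + (- p))"
      using a by (intro vanishing_order_add) auto
    then show False by simp
  qed
  then show "val_ge S 0 (inverse (1 + a))"
    unfolding eq val_ge_def using ne by (intro exI[of _ q] exI[of _ "q + p"]) simp
qed

section \<open>The subfield of functions free of \<open>S\<close>, and reduction to it\<close>

definition degree_zero :: "'v set \<Rightarrow> (('v \<Rightarrow>\<^sub>0 nat) \<Rightarrow>\<^sub>0 int) \<Rightarrow> bool" where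
  "degree_zero S p \<longleftrightarrow> (\<forall>m\<in>Poly_Mapping.keys p. weighted_degree S m = 0)"

lemma degree_zero_add: "degree_zero S p \<Longrightarrow> degree_zero S q \<Longrightarrow> degree_zero S (p + q)"
  unfolding degree_zero_def using keys_add[of p q] by blast

lemma degree_zero_mult: "degree_zero S p \<Longrightarrow> degree_zero S q \<Longrightarrow> degree_zero S (p * q)"
  unfolding degree_zero_def by (metis weighted_degree_keys_mult add.right_neutral)

lemma degree_zero_simps [simp]: "degree_zero S 0" "degree_zero S 1" "degree_zero S (- p) = degree_zero S p"
  by (auto simp: degree_zero_def)

text \<open>The fraction field of the polynomial ring in the indeterminates outside
  \<open>S\<close>; for \<open>S = vanishing_at y\<close> it is the field
  \<open>K y\<close>.\<close>

definition free_of :: "'v::linorder set \<Rightarrow> 'v rational_function \<Rightarrow> bool" where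
  "free_of S a \<longleftrightarrow> (\<exists>p q. q \<noteq> 0 \<and> a = Fract p q \<and> degree_zero S p \<and> degree_zero S q)"

text \<open>A nonzero polynomial without indeterminates from \<open>S\<close> has order 0.\<close>

lemma free_of_imp_val_ge: "free_of S a \<Longrightarrow> val_ge S 0 a"
  unfolding free_of_def val_ge_def degree_zero_def
  by (metis add.left_neutral le_zero_eq of_nat_0 of_nat_0_le_iff vanishing_order_attained)

lemma free_of_add: "free_of S a \<Longrightarrow> free_of S b \<Longrightarrow> free_of S (a + b)"
  unfolding free_of_def by (metis add_fract degree_zero_add degree_zero_mult no_zero_divisors)

lemma free_of_mult: "free_of S a \<Longrightarrow> free_of S b \<Longrightarrow> free_of S (a * b)"
  unfolding free_of_def by (metis mult_fract degree_zero_mult no_zero_divisors)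

lemma free_of_uminus: "free_of S a \<Longrightarrow> free_of S (- a)"
  unfolding free_of_def by (metis minus_fract degree_zero_simps(3))

lemma free_of_zero [simp]: "free_of S 0" and free_of_one [simp]: "free_of S 1"
  unfolding free_of_def
  by (metis degree_zero_simps(1,2) Zero_fract_def one_neq_zero) (metis degree_zero_simps(2) One_fract_def one_neq_zero)

lemma free_of_inverse: "free_of S a \<Longrightarrow> free_of S (inverse a)"
proof (cases "a = 0")
  case False
  assume "free_of S a"
  then obtain p q where "q \<noteq> 0" "a = Fract p q" "degree_zero S p" "degree_zero S q"
    unfolding free_of_def by blast
  moreover from this False have "p \<noteq> 0" by (auto simp: fract_collapse)
  ultimately show ?thesis unfolding free_of_def by auto
qed simp

text \<open>
  The residue field of the valuation is larger than the rational functions free of \<open>S\<close>; only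
  elements whose residue lies in that subfield reduce to something.
\<close>

definition reduces_to :: "'v::linorder set \<Rightarrow> 'v rational_function \<Rightarrow> 'v rational_function \<Rightarrow> bool" where
  "reduces_to S a b \<longleftrightarrow> free_of S b \<and> val_ge S 1 (a - b)"

lemma reduces_to_zero [simp]: "reduces_to S 0 0" and reduces_to_one [simp]: "reduces_to S 1 1"
  by (simp_all add: reduces_to_def)

lemma reduces_to_imp_val_ge: "reduces_to S a b \<Longrightarrow> val_ge S 0 a"
  unfolding reduces_to_def
  using val_ge_add[of S 0 b "a - b"] free_of_imp_val_ge[of S b] val_ge_mono[of S 1 "a - b" 0] by simp

lemma reduces_to_add: "reduces_to S a b \<Longrightarrow> reduces_to S c d \<Longrightarrow> reduces_to S (a + c) (b + d)"
  unfolding reduces_to_def using val_ge_add[of S 1 "a - b" "c - d"]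
  by (simp add: free_of_add algebra_simps)

lemma reduces_to_uminus: "reduces_to S a b \<Longrightarrow> reduces_to S (- a) (- b)"
  unfolding reduces_to_def using val_ge_uminus[of S 1 "a - b"] by (simp add: free_of_uminus)

lemma reduces_to_mult:
  assumes "reduces_to S a b" "reduces_to S c d"
  shows "reduces_to S (a * c) (b * d)"
proof -
  have "val_ge S 1 (a * (c - d) + (a - b) * d)"
    using assms val_ge_mult[of S 0 a 1 "c - d"] val_ge_mult[of S 1 "a - b" 0 d]
      reduces_to_imp_val_ge[of S a b] free_of_imp_val_ge[of S d]
    by (intro val_ge_add) (auto simp: reduces_to_def)
  then show ?thesis using assms by (simp add: reduces_to_def free_of_mult algebra_simps)
qed

lemma reduces_to_power: "reduces_to S a b \<Longrightarrow> reduces_to S (a ^ n) (b ^ n)"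
  by (induction n) (auto intro: reduces_to_mult)

lemma reduces_to_of_nat: "reduces_to S (of_nat n) (of_nat n)"
  by (induction n) (auto intro: reduces_to_add)

text \<open>A nonzero \<open>b\<close> free of \<open>S\<close> is a unit of the valuation ring. So
  \<open>a / b = 1 + c\<close> with \<open>c\<close> of positive order, and
  \<open>inverse a - inverse b = - (c * inverse a)\<close> has positive order too.\<close>

lemma reduces_to_nonzero:
  assumes "reduces_to S a b" "b \<noteq> 0"
  shows "a \<noteq> 0" "reduces_to S (inverse a) (inverse b)"
proof -
  have ib: "free_of S (inverse b)" using assms by (simp add: reduces_to_def free_of_inverse)
  define c where "c = (a - b) * inverse b"
  have c: "val_ge S 1 c"
    using assms val_ge_mult[of S 1 "a - b" 0 "inverse b"] free_of_imp_val_ge[OF ib]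
    by (simp add: reduces_to_def c_def)
  have a: "a = b * (1 + c)" using assms(2) by (simp add: c_def field_simps)
  show a0: "a \<noteq> 0" using a assms(2) val_ge_inverse_one_plus(1)[OF c] by simp
  have "val_ge S 0 (inverse a)"
    using a val_ge_mult[OF free_of_imp_val_ge[OF ib] val_ge_inverse_one_plus(2)[OF c]] by simp
  then have "val_ge S 1 (- (c * inverse a))"
    using val_ge_mult[OF c] by (intro val_ge_uminus) fastforce
  moreover have "- (c * inverse a) = inverse a - inverse b"
    using a0 assms(2) by (simp add: c_def field_simps)
  ultimately show "reduces_to S (inverse a) (inverse b)" by (simp add: reduces_to_def ib)
qed

text \<open>The order of \<open>g = p / q\<close> along any \<open>S\<close> is at most that of
  \<open>p\<close>, hence at most the total degree of any one monomial of \<open>p\<close>. This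
  bound depends on \<open>g\<close> alone, while \<open>a ^ n\<close> has order at least
  \<open>n\<close>, so the quotient has positive order once \<open>n\<close> exceeds the
  bound.\<close>

lemma reduces_to_zero_power_divide:
  fixes g :: "'v::linorder rational_function"
  obtains N where "\<And>S a n. reduces_to S a 0 \<Longrightarrow> N \<le> n \<Longrightarrow> reduces_to S (a ^ n / g) 0"
proof (cases "g = 0")
  case True
  then show ?thesis by (intro that[of 0]) simp
next
  case False
  then obtain p q where g: "g = Fract p q" "p \<noteq> 0" "q \<noteq> 0" by (cases g rule: Fract_cases_nonzero) auto
  then obtain m where m: "m \<in> Poly_Mapping.keys p" by (metis all_not_in_conv keys_eq_empty)
  define N where "N = weighted_degree UNIV m"
  show ?thesis
  proof (rule that[of "Suc N"])
    fix S :: "'v set" and a n assume a: "reduces_to S a 0" and n: "Suc N \<le> n"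
    have "vanishing_order S p \<le> N"
      using vanishing_order_le[OF m] weighted_degree_le order_trans unfolding N_def by blast
    then have "val_ge S (- int N) (inverse g)"
      unfolding g val_ge_def using g by (intro exI[of _ q] exI[of _ p]) auto
    moreover have "val_ge S (int n) (a ^ n)" using a by (simp add: reduces_to_def val_ge_power)
    ultimately have "val_ge S (int n + - int N) (a ^ n * inverse g)" by (rule val_ge_mult[rotated])
    then have "val_ge S 1 (a ^ n * inverse g)" by (rule val_ge_mono) (use n in simp)
    then show "reduces_to S (a ^ n / g) 0" by (simp add: reduces_to_def divide_inverse)
  qed
qed

definition indeterminate :: "'v::linorder \<Rightarrow> 'v rational_function" where
  "indeterminate v = Fract (Poly_Mapping.single (Poly_Mapping.single v 1) 1) 1"

lemma indeterminate_nonzero [simp]: "indeterminate v \<noteq> 0"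
proof -
  have "Poly_Mapping.keys (Poly_Mapping.single (Poly_Mapping.single v 1) (1::int)) \<noteq> {}" by simp
  then have "Poly_Mapping.single (Poly_Mapping.single v 1) (1::int) \<noteq> 0" by (metis keys_zero)
  then show ?thesis by (simp add: indeterminate_def Zero_fract_def eq_fract)
qed

lemma reduces_to_indeterminate:
  shows "v \<notin> S \<Longrightarrow> reduces_to S (indeterminate v) (indeterminate v)"
    and "v \<in> S \<Longrightarrow> reduces_to S (indeterminate v) 0"
proof -
  let ?p = "Poly_Mapping.single (Poly_Mapping.single v 1) (1::int)"
  show "reduces_to S (indeterminate v) (indeterminate v)" if "v \<notin> S"
    using that unfolding reduces_to_def free_of_def indeterminate_def
    by (intro conjI exI[of _ ?p] exI[of _ 1]) (simp_all add: degree_zero_def)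
  show "reduces_to S (indeterminate v) 0" if "v \<in> S"
    using that unfolding reduces_to_def val_ge_def indeterminate_def
    by (intro conjI exI[of _ ?p] exI[of _ 1]) (simp_all add: vanishing_order_def)
qed

text \<open>Characteristic zero provides infinitely many constants, from which
  \<open>Hochster_ring_join\<close> picks its multiplier.\<close>

lemma inj_of_nat_fract: "inj (of_nat :: nat \<Rightarrow> 'v::linorder rational_function)"
  by (auto simp: inj_def eq_fract of_nat_fract)

section \<open>Constructible sets\<close>

lemma quasicompact_open_basis:
  assumes "spectral_space X" "openin X U" "x \<in> U"
  obtains V where "quasicompact_open X V" "x \<in> V" "V \<subseteq> U"
proof -
  have "(arbitrary union_of quasicompact_open X) U"
    using assms(1,2) by (simp add: spectral_space_def)
  then show ?thesis using assms(3) that unfolding union_of_def by blast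
qed

lemma quasicompact_open_topspace: "spectral_space X \<Longrightarrow> quasicompact_open X (topspace X)"
  unfolding spectral_space_def using finite.emptyI by (metis Inf_empty ball_empty inf_top_right)

lemma quasicompact_open_finite_Inter:
  assumes "spectral_space X" "finite \<F>" "\<And>U. U \<in> \<F> \<Longrightarrow> quasicompact_open X U"
  shows "quasicompact_open X (topspace X \<inter> \<Inter>\<F>)"
  using assms by (simp add: spectral_space_def)

lemma quasicompact_open_subset: "quasicompact_open X U \<Longrightarrow> U \<subseteq> topspace X"
  by (simp add: quasicompact_open_def openin_subset)

lemma quasicompact_open_Int:
  assumes "spectral_space X" "quasicompact_open X U" "quasicompact_open X V"
  shows "quasicompact_open X (U \<inter> V)"
proof -
  have "quasicompact_open X (topspace X \<inter> \<Inter>{U, V})"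
    using assms unfolding spectral_space_def by (metis finite.emptyI finite_insert insertE singletonD)
  then show ?thesis
    using quasicompact_open_subset[OF assms(2)] by (simp add: Int_absorb1 flip: Int_assoc)
qed

lemma quasicompact_open_finite_subcover:
  assumes "quasicompact_open X U" "\<And>V. V \<in> \<U> \<Longrightarrow> openin X V" "U \<subseteq> \<Union>\<U>"
  obtains \<V> where "finite \<V>" "\<V> \<subseteq> \<U>" "U \<subseteq> \<Union>\<V>"
  using assms unfolding quasicompact_open_def compactin_def by metis

text \<open>\<open>G\<close> is a prime filter of quasicompact open sets: \<open>prime\<close>
  contains upward closure as the case of a one-element family and properness as that of the empty
  family. The complement \<open>Z\<close> of the union of all nonmembers is irreducible, and an open
  set meets \<open>Z\<close> iff it contains the generic point of \<open>Z\<close>.\<close>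

lemma prime_filter_point:
  assumes X: "spectral_space X"
    and top: "G (topspace X)"
    and int: "\<And>U V. quasicompact_open X U \<Longrightarrow> quasicompact_open X V \<Longrightarrow> G U \<Longrightarrow> G V \<Longrightarrow> G (U \<inter> V)"
    and prime: "\<And>U \<U>. finite \<U> \<Longrightarrow> (\<And>V. V \<in> \<U> \<Longrightarrow> quasicompact_open X V) \<Longrightarrow> quasicompact_open X U \<Longrightarrow>
      G U \<Longrightarrow> U \<subseteq> \<Union>\<U> \<Longrightarrow> \<exists>V\<in>\<U>. G V"
  shows "\<exists>x\<in>topspace X. \<forall>U. quasicompact_open X U \<longrightarrow> (x \<in> U \<longleftrightarrow> G U)"
proof -
  let ?N = "{U. quasicompact_open X U \<and> \<not> G U}"
  define Z where "Z = topspace X - \<Union>?N"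
  have meets: "U \<inter> Z \<noteq> {}" if U: "quasicompact_open X U" "G U" for U
  proof
    assume "U \<inter> Z = {}"
    then have "U \<subseteq> \<Union>?N" using quasicompact_open_subset[OF U(1)] by (auto simp: Z_def)
    then obtain \<V> where "finite \<V>" "\<V> \<subseteq> ?N" "U \<subseteq> \<Union>\<V>"
      by (rule quasicompact_open_finite_subcover[OF U(1), rotated]) (auto simp: quasicompact_open_def)
    then show False using prime[of \<V> U] U by blast
  qed
  have "irreducible_closedin X Z"
    unfolding irreducible_closedin_def
  proof (intro conjI allI impI)
    show "closedin X Z" unfolding Z_def
      by (intro closedin_diff closedin_topspace openin_Union) (auto simp: quasicompact_open_def)
    show "Z \<noteq> {}" using meets[OF quasicompact_open_topspace[OF X] top] by auto
    fix A B assume AB: "closedin X A \<and> closedin X B \<and> Z = A \<union> B"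
    show "Z = A \<or> Z = B"
    proof (rule ccontr)
      assume "\<not> ?thesis"
      then obtain a b where a: "a \<in> Z" "a \<notin> A" and b: "b \<in> Z" "b \<notin> B" using AB by blast
      have "a \<in> topspace X - A" "b \<in> topspace X - B" using a b by (auto simp: Z_def)
      moreover have "openin X (topspace X - A)" "openin X (topspace X - B)" using AB by auto
      ultimately obtain U V where U: "quasicompact_open X U" "a \<in> U" "U \<subseteq> topspace X - A"
        and V: "quasicompact_open X V" "b \<in> V" "V \<subseteq> topspace X - B"
        using quasicompact_open_basis[OF X] by metis
      \<comment> \<open>\<open>Z\<close> is disjoint from every nonmember, whereas \<open>U\<close>
        and \<open>V\<close> contain points of \<open>Z\<close>.\<close>
      have "G U" "G V" using a b U V by (auto simp: Z_def)
      then have "(U \<inter> V) \<inter> Z \<noteq> {}"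
        using U V by (intro meets int quasicompact_open_Int[OF X])
      then show False using U V AB by blast
    qed
  qed
  then obtain x where "generic_point X Z x" using X unfolding spectral_space_def by blast
  then have x: "x \<in> topspace X" "X closure_of {x} = Z" by (auto simp: generic_point_def)
  have "x \<in> U \<longleftrightarrow> G U" if U: "quasicompact_open X U" for U
  proof
    have "x \<in> Z" using x by (metis closure_of_subset empty_subsetI insert_subset)
    then show "G U" if "x \<in> U" using that U by (auto simp: Z_def)
    show "x \<in> U" if GU: "G U"
    proof -
      obtain z where "z \<in> U" "z \<in> X closure_of {x}" using meets[OF U GU] x(2) by blast
      then show ?thesis using U by (auto simp: in_closure_of quasicompact_open_def)
    qed
  qed
  then show ?thesis using x by blast
qed

text \<open>Both points have the same closure, and the closure of a point is irreducible, so
  uniqueness of generic points applies.\<close>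

lemma spectral_space_separated:
  assumes X: "spectral_space X" and x: "x \<in> topspace X" and y: "y \<in> topspace X"
    and eq: "\<And>U. quasicompact_open X U \<Longrightarrow> x \<in> U \<longleftrightarrow> y \<in> U"
  shows "x = y"
proof -
  have op: "x \<in> U \<longleftrightarrow> y \<in> U" if "openin X U" for U
    using quasicompact_open_basis[OF X that] eq by blast
  have cl: "X closure_of {x} = X closure_of {y}" by (auto simp: closure_of_def op)
  have "irreducible_closedin X (X closure_of {x})"
    unfolding irreducible_closedin_def
  proof (intro conjI allI impI)
    have mem: "x \<in> X closure_of {x}" using x by (metis closure_of_subset empty_subsetI insert_subset)
    then show "X closure_of {x} \<noteq> {}" by blast
    fix A B assume AB: "closedin X A \<and> closedin X B \<and> X closure_of {x} = A \<union> B"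
    then have "x \<in> A \<or> x \<in> B" using mem by auto
    then have "X closure_of {x} \<subseteq> A \<or> X closure_of {x} \<subseteq> B"
      using AB closure_of_minimal[of "{x}" _ X] by blast
    then show "X closure_of {x} = A \<or> X closure_of {x} = B" using AB by blast
  qed simp
  then have "\<exists>!z. generic_point X (X closure_of {x}) z" using X by (simp add: spectral_space_def)
  moreover have "generic_point X (X closure_of {x}) x" using x by (simp add: generic_point_def)
  moreover have "generic_point X (X closure_of {x}) y" using y cl by (simp add: generic_point_def)
  ultimately show ?thesis by blast
qed

section \<open>The constructible topology\<close>

inductive constructible :: "'a topology \<Rightarrow> 'a set \<Rightarrow> bool" for X where
  quasicompact_open: "quasicompact_open X U \<Longrightarrow> constructible X U"
| complement: "constructible X C \<Longrightarrow> constructible X (topspace X - C)"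
| Int: "constructible X C \<Longrightarrow> constructible X D \<Longrightarrow> constructible X (C \<inter> D)"

lemma constructible_subset: "constructible X C \<Longrightarrow> C \<subseteq> topspace X"
  by (induction rule: constructible.induct) (auto dest: quasicompact_open_subset)

lemma constructible_Un:
  assumes "constructible X C" "constructible X D"
  shows "constructible X (C \<union> D)"
proof -
  have "C \<union> D = topspace X - ((topspace X - C) \<inter> (topspace X - D))"
    using assms[THEN constructible_subset] by auto
  then show ?thesis using assms by (metis constructible.complement constructible.Int)
qed

lemma constructible_UN:
  assumes "spectral_space X" "finite I" "\<And>i. i \<in> I \<Longrightarrow> constructible X (C i)"
  shows "constructible X (\<Union>i\<in>I. C i)"
  using assms(2,3)
proof (induction I rule: finite_induct)
  case empty
  have "constructible X (topspace X - topspace X)"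
    using assms(1) by (intro constructible.intros quasicompact_open_topspace)
  then show ?case by simp
qed (simp add: constructible_Un)

text \<open>Zorn's lemma gives a maximal family with the finite intersection property. If it
  contained neither \<open>S\<close> nor \<open>- S\<close>, adding either would destroy the
  property, and the two finite witnesses together would have empty intersection.\<close>

lemma finite_intersection_property_ultrafilter:
  fixes \<C> :: "'a set set"
  assumes "\<And>\<F>. finite \<F> \<Longrightarrow> \<F> \<subseteq> \<C> \<Longrightarrow> \<Inter>\<F> \<noteq> {}"
  shows "\<exists>\<M>. \<C> \<subseteq> \<M> \<and> (\<forall>\<F>. finite \<F> \<longrightarrow> \<F> \<subseteq> \<M> \<longrightarrow> \<Inter>\<F> \<noteq> {}) \<and> (\<forall>S. S \<in> \<M> \<or> - S \<in> \<M>)"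
proof -
  let ?A = "{\<M>. \<C> \<subseteq> \<M> \<and> (\<forall>\<F>. finite \<F> \<and> \<F> \<subseteq> \<M> \<longrightarrow> \<Inter>\<F> \<noteq> {})}"
  have "\<exists>\<M>\<in>?A. \<forall>\<N>\<in>?A. \<M> \<subseteq> \<N> \<longrightarrow> \<N> = \<M>"
  proof (rule subset_Zorn_nonempty)
    show "?A \<noteq> {}" using assms by blast
    fix \<K> assume K: "\<K> \<noteq> {}" "subset.chain ?A \<K>"
    have "\<Inter>\<F> \<noteq> {}" if F: "finite \<F>" "\<F> \<subseteq> \<Union>\<K>" for \<F>
    proof -
      obtain \<N> where "\<N> \<in> \<K>" "\<F> \<subseteq> \<N>" using finite_subset_Union_chain[OF F K] by blast
      then show ?thesis using F(1) K(2) by (auto simp: subset_chain_def)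
    qed
    moreover have "\<C> \<subseteq> \<Union>\<K>" using K unfolding subset_chain_def by blast
    ultimately show "\<Union>\<K> \<in> ?A" by blast
  qed
  then obtain \<M> where MA: "\<M> \<in> ?A" and max: "\<forall>\<N>\<in>?A. \<M> \<subseteq> \<N> \<longrightarrow> \<N> = \<M>" ..
  have M: "\<C> \<subseteq> \<M>" "\<forall>\<F>. finite \<F> \<longrightarrow> \<F> \<subseteq> \<M> \<longrightarrow> \<Inter>\<F> \<noteq> {}" using MA by simp_all
  have ext: "\<exists>\<F>. finite \<F> \<and> \<F> \<subseteq> \<M> \<and> S \<inter> \<Inter>\<F> = {}" if "S \<notin> \<M>" for S
  proof -
    have "insert S \<M> \<notin> ?A"
    proof
      assume "insert S \<M> \<in> ?A"
      from bspec[OF max this] show False using that by auto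
    qed
    then obtain \<F> where "finite \<F>" "\<F> \<subseteq> insert S \<M>" "\<Inter>\<F> = {}" using M(1) by auto
    then show ?thesis by (intro exI[of _ "\<F> - {S}"]) auto
  qed
  have "S \<in> \<M> \<or> - S \<in> \<M>" for S
  proof (rule ccontr)
    assume "\<not> ?thesis"
    then obtain \<F> \<G> where "finite \<F>" "\<F> \<subseteq> \<M>" "S \<inter> \<Inter>\<F> = {}" "finite \<G>" "\<G> \<subseteq> \<M>" "- S \<inter> \<Inter>\<G> = {}"
      using ext by metis
    moreover from this have "\<Inter>(\<F> \<union> \<G>) \<noteq> {}" using M(2) by (metis finite_UnI Un_subset_iff)
    ultimately show False by blast
  qed
  then show ?thesis using M by (intro exI[of _ \<M>]) simp
qed

text \<open>Compactness of the constructible topology. Extend the family to an ultrafilter; its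
  quasicompact open members form a prime filter, and the point of that filter lies in exactly those
  constructible sets that belong to the ultrafilter.\<close>

lemma constructible_compact:
  assumes X: "spectral_space X"
    and C: "\<And>C. C \<in> \<C> \<Longrightarrow> constructible X C"
    and fip: "\<And>\<F>. finite \<F> \<Longrightarrow> \<F> \<subseteq> \<C> \<Longrightarrow> topspace X \<inter> \<Inter>\<F> \<noteq> {}"
  shows "\<exists>x\<in>topspace X. \<forall>C\<in>\<C>. x \<in> C"
proof -
  have "\<Inter>\<F> \<noteq> {}" if "finite \<F>" "\<F> \<subseteq> insert (topspace X) \<C>" for \<F>
  proof -
    have "topspace X \<inter> \<Inter>(\<F> - {topspace X}) \<noteq> {}" using that by (intro fip) auto
    then show ?thesis by blast
  qed
  then have "\<exists>\<M>. insert (topspace X) \<C> \<subseteq> \<M> \<and> (\<forall>\<F>. finite \<F> \<longrightarrow> \<F> \<subseteq> \<M> \<longrightarrow> \<Inter>\<F> \<noteq> {}) \<and>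
      (\<forall>S. S \<in> \<M> \<or> - S \<in> \<M>)"
    by (rule finite_intersection_property_ultrafilter)
  then obtain \<M> where M: "insert (topspace X) \<C> \<subseteq> \<M>"
    and fin: "\<And>\<F>. finite \<F> \<Longrightarrow> \<F> \<subseteq> \<M> \<Longrightarrow> \<Inter>\<F> \<noteq> {}" and ult: "\<And>S. S \<in> \<M> \<or> - S \<in> \<M>"
    by (elim exE conjE) metis
  \<comment> \<open>Membership in \<open>\<M>\<close> respects Boolean operations just as membership
    of a point does; this drives the induction over constructible sets.\<close>
  have int: "U \<inter> V \<in> \<M> \<longleftrightarrow> U \<in> \<M> \<and> V \<in> \<M>" for U V
    using fin[of "{U, V, - (U \<inter> V)}"] fin[of "{U \<inter> V, - U}"] fin[of "{U \<inter> V, - V}"]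
      ult[of "U \<inter> V"] ult[of U] ult[of V] by auto
  have compl: "topspace X - U \<in> \<M> \<longleftrightarrow> U \<notin> \<M>" for U
    using fin[of "{topspace X - U, U}"] int[of "topspace X" "- U"] M ult[of U] by (auto simp: Diff_eq)
  have "\<exists>x\<in>topspace X. \<forall>U. quasicompact_open X U \<longrightarrow> (x \<in> U \<longleftrightarrow> U \<in> \<M>)"
  proof (rule prime_filter_point[OF X])
    show "topspace X \<in> \<M>" using M by simp
    show "U \<inter> V \<in> \<M>" if "U \<in> \<M>" "V \<in> \<M>" for U V using that int by blast
    fix U \<U> assume U: "finite \<U>" "U \<in> \<M>" "U \<subseteq> \<Union>\<U>"
    show "\<exists>V\<in>\<U>. V \<in> \<M>"
    proof (rule ccontr)
      assume "\<not> ?thesis"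
      then have "uminus ` \<U> \<subseteq> \<M>" using ult by blast
      then have "\<Inter>(insert U (uminus ` \<U>)) \<noteq> {}" using U by (intro fin) auto
      then show False using U(3) by auto
    qed
  qed
  then obtain x where x: "x \<in> topspace X" "\<And>U. quasicompact_open X U \<Longrightarrow> x \<in> U \<longleftrightarrow> U \<in> \<M>" by blast
  have "constructible X C \<Longrightarrow> x \<in> C \<longleftrightarrow> C \<in> \<M>" for C
    by (induction rule: constructible.induct) (use x int compl in auto)
  then show ?thesis using x M C by blast
qed

text \<open>Both halves follow from compactness of the constructible topology. If no quasicompact
  open neighbourhood of \<open>y\<close> lies in \<open>C\<close>, these neighbourhoods share a
  point outside \<open>C\<close>, and it is a generization of \<open>y\<close>. If an open cover of
  \<open>C\<close> had no finite subcover, some point of \<open>C\<close> would be left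
  uncovered.\<close>

lemma constructible_generization_stable:
  assumes X: "spectral_space X" and C: "constructible X C"
    and gen: "\<And>x y. y \<in> C \<Longrightarrow> x \<in> topspace X \<Longrightarrow> (\<And>U. quasicompact_open X U \<Longrightarrow> y \<in> U \<Longrightarrow> x \<in> U) \<Longrightarrow> x \<in> C"
  shows "quasicompact_open X C"
proof -
  have sub: "C \<subseteq> topspace X" by (rule constructible_subset[OF C])
  have nbhd: "\<exists>W. quasicompact_open X W \<and> y \<in> W \<and> W \<subseteq> C" if y: "y \<in> C" for y
  proof (rule ccontr)
    assume no: "\<not> ?thesis"
    let ?W = "{W. quasicompact_open X W \<and> y \<in> W}"
    have "\<exists>x\<in>topspace X. \<forall>D\<in>insert (topspace X - C) ?W. x \<in> D"
    proof (rule constructible_compact[OF X])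
      fix D assume "D \<in> insert (topspace X - C) ?W"
      then show "constructible X D"
        using C by (auto intro: constructible.quasicompact_open constructible.complement)
    next
      fix \<F> assume F: "finite \<F>" "\<F> \<subseteq> insert (topspace X - C) ?W"
      let ?F = "\<F> - {topspace X - C}"
      have "quasicompact_open X (topspace X \<inter> \<Inter>?F)"
        using F by (intro quasicompact_open_finite_Inter[OF X]) auto
      moreover have "y \<in> topspace X \<inter> \<Inter>?F" using y sub F(2) by auto
      ultimately have "\<not> topspace X \<inter> \<Inter>?F \<subseteq> C" using no by blast
      then show "topspace X \<inter> \<Inter>\<F> \<noteq> {}" by blast
    qed
    then obtain x where x: "x \<in> topspace X" "\<forall>D\<in>insert (topspace X - C) ?W. x \<in> D" ..
    then have "x \<in> C" by (intro gen[OF y]) simp_all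
    then show False using x(2) by simp
  qed
  have "openin X C"
    by (subst openin_subopen) (use nbhd in \<open>auto simp: quasicompact_open_def\<close>)
  moreover have "compactin X C"
    unfolding compactin_def
  proof (intro conjI allI impI sub)
    fix \<U> assume U: "(\<forall>U\<in>\<U>. openin X U) \<and> C \<subseteq> \<Union>\<U>"
    show "\<exists>\<F>. finite \<F> \<and> \<F> \<subseteq> \<U> \<and> C \<subseteq> \<Union>\<F>"
    proof (rule ccontr)
      assume no: "\<not> ?thesis"
      \<comment> \<open>Members of the cover need not be constructible, so the quasicompact open
        sets inside them take their place.\<close>
      let ?D = "{topspace X - V | V. quasicompact_open X V \<and> (\<exists>U\<in>\<U>. V \<subseteq> U)}"
      have "\<exists>x\<in>topspace X. \<forall>D\<in>insert C ?D. x \<in> D"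
      proof (rule constructible_compact[OF X])
        fix D assume "D \<in> insert C ?D"
        then show "constructible X D"
          using C by (auto intro: constructible.quasicompact_open constructible.complement)
      next
        fix \<F> assume F: "finite \<F>" "\<F> \<subseteq> insert C ?D"
        have "\<exists>U. U \<in> \<U> \<and> topspace X - U \<subseteq> D" if "D \<in> \<F> - {C}" for D
        proof -
          have "D \<in> ?D" using that F(2) by blast
          then show ?thesis by blast
        qed
        then obtain u where u: "\<And>D. D \<in> \<F> - {C} \<Longrightarrow> u D \<in> \<U> \<and> topspace X - u D \<subseteq> D" by metis
        then have "finite (u ` (\<F> - {C}))" "u ` (\<F> - {C}) \<subseteq> \<U>" using F(1) by auto
        then have "\<not> C \<subseteq> \<Union>(u ` (\<F> - {C}))" using no by metis
        then obtain c where c: "c \<in> C" "\<And>D. D \<in> \<F> - {C} \<Longrightarrow> c \<notin> u D" by blast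
        have "c \<in> D" if "D \<in> \<F>" for D using that c u[of D] sub by blast
        then show "topspace X \<inter> \<Inter>\<F> \<noteq> {}" using c(1) sub by blast
      qed
      then obtain x where x: "\<forall>D\<in>insert C ?D. x \<in> D" ..
      then have "x \<in> C" by simp
      then obtain U where "U \<in> \<U>" "x \<in> U" using U by blast
      then obtain V where "quasicompact_open X V" "x \<in> V" "V \<subseteq> U"
        using U quasicompact_open_basis[OF X] by metis
      moreover from this have "topspace X - V \<in> insert C ?D" using \<open>U \<in> \<U>\<close> by blast
      ultimately show False using bspec[OF x] by blast
    qed
  qed
  ultimately show ?thesis by (simp add: quasicompact_open_def)
qed

text \<open>For spectral \<open>X\<close> these are the continuous maps from the constructible
  topology to a discrete space. Finiteness of the image later yields a uniform exponent and a
  multiplier that works at all points.\<close>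

definition constructible_map :: "'a topology \<Rightarrow> ('a \<Rightarrow> 'b) \<Rightarrow> bool" where
  "constructible_map X f \<longleftrightarrow> finite (f ` topspace X) \<and> (\<forall>A. constructible X {x \<in> topspace X. f x \<in> A})"

text \<open>Only finitely many pairs of values occur, each on a constructible set, so
  \<open>h\<close> can be arbitrary.\<close>

lemma constructible_map_combine:
  assumes X: "spectral_space X" and f: "constructible_map X f" and g: "constructible_map X g"
  shows "constructible_map X (\<lambda>x. h (f x) (g x))"
  unfolding constructible_map_def
proof
  let ?I = "f ` topspace X \<times> g ` topspace X"
  have fin: "finite ?I" using f g by (simp add: constructible_map_def)
  have "(\<lambda>x. h (f x) (g x)) ` topspace X \<subseteq> (\<lambda>(a, b). h a b) ` ?I" by auto
  then show "finite ((\<lambda>x. h (f x) (g x)) ` topspace X)" using fin finite_surj by blast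
  show "\<forall>A. constructible X {x \<in> topspace X. h (f x) (g x) \<in> A}"
  proof
    fix A
    let ?J = "{(a, b) \<in> ?I. h a b \<in> A}"
    have "finite ?J" by (rule finite_subset[OF _ fin]) auto
    then have "constructible X (\<Union>ab\<in>?J. {x \<in> topspace X. f x \<in> {fst ab}} \<inter> {x \<in> topspace X. g x \<in> {snd ab}})"
      using f g unfolding constructible_map_def
      by (intro constructible_UN[OF X] constructible.Int) blast+
    moreover have "(\<Union>ab\<in>?J. {x \<in> topspace X. f x \<in> {fst ab}} \<inter> {x \<in> topspace X. g x \<in> {snd ab}}) =
        {x \<in> topspace X. h (f x) (g x) \<in> A}" by force
    ultimately show "constructible X {x \<in> topspace X. h (f x) (g x) \<in> A}" by simp
  qed
qed

lemma constructible_map_indicator: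
  assumes X: "spectral_space X" and U: "quasicompact_open X U"
  shows "constructible_map X (\<lambda>x. if x \<in> U then a else b)"
  unfolding constructible_map_def
proof
  have "(\<lambda>x. if x \<in> U then a else b) ` topspace X \<subseteq> {a, b}" by auto
  then show "finite ((\<lambda>x. if x \<in> U then a else b) ` topspace X)" by (rule finite_subset) simp
  show "\<forall>A. constructible X {x \<in> topspace X. (if x \<in> U then a else b) \<in> A}"
  proof
    fix A
    note U' = constructible.quasicompact_open[OF U]
      constructible.quasicompact_open[OF quasicompact_open_topspace[OF X]]
    \<comment> \<open>The empty set is written as a complement to match
      \<open>constructible.complement\<close>.\<close>
    have "{x \<in> topspace X. (if x \<in> U then a else b) \<in> A} =
        (if a \<in> A then if b \<in> A then topspace X else U
         else if b \<in> A then topspace X - U else topspace X - topspace X)"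
      using quasicompact_open_subset[OF U] by auto
    then show "constructible X {x \<in> topspace X. (if x \<in> U then a else b) \<in> A}"
      using U' U'[THEN constructible.complement] by (auto simp del: Diff_cancel)
  qed
qed

section \<open>Recognizing prime spectra\<close>

text \<open>\<open>D f\<close> stands for the set where \<open>f\<close> does not vanish.
  \<open>support_divides\<close> makes membership in a prime ideal depend on \<open>D f\<close>
  only, and \<open>support_join\<close> makes the supports of its members directed. The abstract
  form lets the result apply to a copy of the function ring on another type.\<close>

locale spectral_support = cring R for R (structure) +
  fixes X :: "'c topology" and D :: "'a \<Rightarrow> 'c set"
  assumes spectral: "spectral_space X"
    and support: "\<And>f. f \<in> carrier R \<Longrightarrow> quasicompact_open X (D f)"
    and support_surj: "\<And>U. quasicompact_open X U \<Longrightarrow> \<exists>f\<in>carrier R. D f = U"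
    and support_zero: "D \<zero> = {}" and support_one: "D \<one> = topspace X"
    and support_mult: "\<And>f g. f \<in> carrier R \<Longrightarrow> g \<in> carrier R \<Longrightarrow> D (f \<otimes> g) = D f \<inter> D g"
    and support_add: "\<And>f g. f \<in> carrier R \<Longrightarrow> g \<in> carrier R \<Longrightarrow> D (f \<oplus> g) \<subseteq> D f \<union> D g"
    and support_divides: "\<And>f g. f \<in> carrier R \<Longrightarrow> g \<in> carrier R \<Longrightarrow> D f \<subseteq> D g \<Longrightarrow>
      \<exists>n::nat. \<exists>h\<in>carrier R. f [^] n = g \<otimes> h"
    and support_join: "\<And>f g. f \<in> carrier R \<Longrightarrow> g \<in> carrier R \<Longrightarrow>
      \<exists>c\<in>carrier R. D (f \<oplus> c \<otimes> g) = D f \<union> D g"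
begin

definition vanishing_ideal :: "'c \<Rightarrow> 'a set" where
  "vanishing_ideal x = {f \<in> carrier R. x \<notin> D f}"

lemma support_subset: "f \<in> carrier R \<Longrightarrow> D f \<subseteq> topspace X"
  by (rule quasicompact_open_subset[OF support])

lemma vanishing_ideal_mult:
  "f \<in> vanishing_ideal x \<Longrightarrow> g \<in> carrier R \<Longrightarrow> f \<otimes> g \<in> vanishing_ideal x"
  by (auto simp: vanishing_ideal_def support_mult)

lemma ideal_vanishing_ideal: "ideal (vanishing_ideal x) R"
proof (rule idealI)
  show "subgroup (vanishing_ideal x) (add_monoid R)"
  proof (rule add.subgroupI)
    show "vanishing_ideal x \<subseteq> carrier R" "vanishing_ideal x \<noteq> {}"
      using support_zero by (auto simp: vanishing_ideal_def)
    show "f \<oplus> g \<in> vanishing_ideal x" if "f \<in> vanishing_ideal x" "g \<in> vanishing_ideal x" for f g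
      using that support_add[of f g] by (auto simp: vanishing_ideal_def)
    show "\<ominus> f \<in> vanishing_ideal x" if "f \<in> vanishing_ideal x" for f
      using vanishing_ideal_mult[OF that, of "\<ominus> \<one>"] that by (simp add: vanishing_ideal_def r_minus)
  qed
  show "f \<otimes> g \<in> vanishing_ideal x" if "f \<in> vanishing_ideal x" "g \<in> carrier R" for f g
    using vanishing_ideal_mult that .
  show "g \<otimes> f \<in> vanishing_ideal x" if "f \<in> vanishing_ideal x" "g \<in> carrier R" for f g
    using vanishing_ideal_mult[OF that] that by (simp add: vanishing_ideal_def m_comm)
qed (rule ring_axioms)

lemma primeideal_vanishing_ideal: "primeideal (vanishing_ideal x) R" if "x \<in> topspace X"
proof (rule primeidealI)
  show "carrier R \<noteq> vanishing_ideal x" using that support_one by (auto simp: vanishing_ideal_def)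
  show "f \<in> vanishing_ideal x \<or> g \<in> vanishing_ideal x"
    if "f \<in> carrier R" "g \<in> carrier R" "f \<otimes> g \<in> vanishing_ideal x" for f g
    using that by (auto simp: vanishing_ideal_def support_mult)
qed (rule ideal_vanishing_ideal is_cring)+

lemma primeideal_closed:
  assumes "primeideal P R"
  shows "P \<subseteq> carrier R" "\<one> \<notin> P" "\<zero> \<in> P"
    and "\<And>f g. f \<in> P \<Longrightarrow> g \<in> P \<Longrightarrow> f \<oplus> g \<in> P"
    and "\<And>f g. f \<in> P \<Longrightarrow> g \<in> carrier R \<Longrightarrow> f \<otimes> g \<in> P"
    and "\<And>f g. f \<in> P \<Longrightarrow> g \<in> carrier R \<Longrightarrow> g \<otimes> f \<in> P"
proof -
  note P = primeideal.axioms(1)[OF assms]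
  note sub = ideal.axioms(1)[OF P]
  show "P \<subseteq> carrier R" by (rule additive_subgroup.a_subset[OF sub])
  show "\<one> \<notin> P" using primeideal.I_notcarr[OF assms] ideal.one_imp_carrier[OF P] by metis
  show "\<zero> \<in> P" by (rule additive_subgroup.zero_closed[OF sub])
  show "f \<oplus> g \<in> P" if "f \<in> P" "g \<in> P" for f g
    using that by (rule additive_subgroup.a_closed[OF sub])
  show "f \<otimes> g \<in> P" if "f \<in> P" "g \<in> carrier R" for f g
    using that by (rule ideal.I_r_closed[OF P])
  show "g \<otimes> f \<in> P" if "f \<in> P" "g \<in> carrier R" for f g
    using that by (rule ideal.I_l_closed[OF P])
qed

text \<open>By \<open>support_divides\<close> some power of \<open>f\<close> is a multiple of
  \<open>g\<close>.\<close>

lemma primeideal_support_mono: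
  assumes P: "primeideal P R" and f: "f \<in> carrier R" and g: "g \<in> P" and sub: "D f \<subseteq> D g"
  shows "f \<in> P"
proof -
  note closed = primeideal_closed[OF P]
  have "g \<in> carrier R" using g closed(1) by blast
  then obtain n :: nat and h where h: "h \<in> carrier R" "f [^] n = g \<otimes> h"
    using support_divides[OF f _ sub] by blast
  then have "f [^] n \<in> P" using closed(5)[OF g] by simp
  \<comment> \<open>The exponent may be 0; that case is excluded by
    \<open>\<one> \<notin> P\<close>.\<close>
  moreover have "f [^] n \<in> P \<Longrightarrow> f \<in> P" for n :: nat
    by (induction n) (use closed(2) f primeideal.I_prime[OF P] in auto)
  ultimately show ?thesis by blast
qed

text \<open>\<open>support_join\<close> realizes the union of two supports by a combination
  \<open>f \<oplus> c \<otimes> g\<close>, which stays in the ideal.\<close>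

lemma primeideal_support_directed:
  assumes P: "primeideal P R" and "finite \<U>" "\<U> \<subseteq> D ` P"
  shows "\<exists>g\<in>P. \<Union>\<U> = D g"
  using assms(2,3)
proof (induction \<U> rule: finite_induct)
  case empty
  show ?case using support_zero primeideal_closed(3)[OF P] by (intro bexI[of _ \<zero>]) auto
next
  case (insert U \<U>)
  note closed = primeideal_closed[OF P]
  obtain f g where f: "f \<in> P" "U = D f" and g: "g \<in> P" "\<Union>\<U> = D g" using insert by blast
  have "f \<in> carrier R" "g \<in> carrier R" using f g closed(1) by auto
  then obtain c where c: "c \<in> carrier R" "D (f \<oplus> c \<otimes> g) = D f \<union> D g" using support_join by blast
  have "f \<oplus> c \<otimes> g \<in> P" by (intro closed(4,6) f g c)
  then show ?case using c f g by (intro bexI[of _ "f \<oplus> c \<otimes> g"]) auto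
qed

text \<open>The supports of elements outside \<open>P\<close> form a prime filter, and its point is
  the required \<open>x\<close>.\<close>

lemma primeideal_imp_vanishing_ideal:
  assumes P: "primeideal P R"
  shows "\<exists>x\<in>topspace X. P = vanishing_ideal x"
proof -
  note closed = primeideal_closed[OF P]
  define G where "G U \<longleftrightarrow> (\<exists>f\<in>carrier R - P. D f = U)" for U
  have "\<exists>x\<in>topspace X. \<forall>U. quasicompact_open X U \<longrightarrow> (x \<in> U \<longleftrightarrow> G U)"
  proof (rule prime_filter_point[OF spectral])
    show "G (topspace X)" unfolding G_def using closed(2) support_one by (intro bexI[of _ \<one>]) auto
    show "G (U \<inter> V)" if "G U" "G V" for U V
    proof -
      obtain f where f: "f \<in> carrier R - P" "D f = U" using \<open>G U\<close> unfolding G_def ..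
      obtain g where g: "g \<in> carrier R - P" "D g = V" using \<open>G V\<close> unfolding G_def ..
      have "f \<otimes> g \<in> carrier R - P" using f g primeideal.I_prime[OF P, of f g] by auto
      moreover have "D (f \<otimes> g) = U \<inter> V" using f g support_mult by simp
      ultimately show ?thesis unfolding G_def by (rule bexI[rotated])
    qed
    fix U \<U> assume U: "finite \<U>" "\<And>V. V \<in> \<U> \<Longrightarrow> quasicompact_open X V" "G U" "U \<subseteq> \<Union>\<U>"
    show "\<exists>V\<in>\<U>. G V"
    proof (rule ccontr)
      assume no: "\<not> ?thesis"
      \<comment> \<open>Each \<open>V\<close> is the support of some element, which must lie in
        \<open>P\<close>. Then \<open>\<Union>\<U>\<close> is the support of a member of
        \<open>P\<close>, and any \<open>f\<close> supported inside it lies in \<open>P\<close> as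
        well.\<close>
      have "\<U> \<subseteq> D ` P"
      proof
        fix V assume V: "V \<in> \<U>"
        then obtain f where "f \<in> carrier R" "D f = V" using support_surj[OF U(2)] by blast
        then show "V \<in> D ` P" using no V unfolding G_def by blast
      qed
      then obtain g where g: "g \<in> P" "\<Union>\<U> = D g"
        using primeideal_support_directed[OF P U(1)] by blast
      obtain f where f: "f \<in> carrier R - P" "D f = U" using U(3) unfolding G_def ..
      then show False using primeideal_support_mono[OF P _ g(1), of f] g(2) U(4) by simp
    qed
  qed
  then obtain x where x: "x \<in> topspace X" "\<And>U. quasicompact_open X U \<Longrightarrow> x \<in> U \<longleftrightarrow> G U" by blast
  have "f \<in> P \<longleftrightarrow> x \<notin> D f" if f: "f \<in> carrier R" for f
  proof -
    have "x \<in> D f \<longleftrightarrow> (\<exists>g\<in>carrier R - P. D g = D f)" using x(2)[OF support[OF f]] by (simp add: G_def)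
    also have "\<dots> \<longleftrightarrow> f \<notin> P" using primeideal_support_mono[OF P] f by blast
    finally show ?thesis by blast
  qed
  then have "P = vanishing_ideal x" using closed(1) by (auto simp: vanishing_ideal_def)
  then show ?thesis using x(1) by blast
qed

lemma vanishing_ideal_image: "vanishing_ideal ` topspace X = prime_spectrum R"
  using primeideal_vanishing_ideal primeideal_imp_vanishing_ideal by (auto simp: prime_spectrum_def)

lemma vanishing_ideal_preimage:
  assumes "S \<subseteq> carrier R"
  shows "{x \<in> topspace X. vanishing_ideal x \<in> prime_spectrum R - zariski_closed R S} = (\<Union>f\<in>S. D f)"
  using assms support_subset primeideal_vanishing_ideal
  unfolding zariski_closed_def prime_spectrum_def vanishing_ideal_def by blast

lemma continuous_map_vanishing_ideal: "continuous_map X (Spec R) vanishing_ideal"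
  unfolding continuous_map_def
proof (intro conjI allI impI)
  show "vanishing_ideal \<in> topspace X \<rightarrow> topspace (Spec R)"
    using vanishing_ideal_image by (auto simp: topspace_Spec)
  fix W assume "openin (Spec R) W"
  then obtain S where S: "S \<subseteq> carrier R" "W = prime_spectrum R - zariski_closed R S"
    by (auto simp: openin_Spec)
  show "openin X {x \<in> topspace X. vanishing_ideal x \<in> W}"
    unfolding S(2) vanishing_ideal_preimage[OF S(1)]
    by (rule openin_Union) (use S(1) support in \<open>auto simp: quasicompact_open_def\<close>)
qed

lemma open_map_vanishing_ideal: "open_map X (Spec R) vanishing_ideal"
  unfolding open_map_def
proof (intro allI impI)
  fix U assume U: "openin X U"
  \<comment> \<open>Every quasicompact open subset of \<open>U\<close> is the support of some
    element of \<open>?S\<close>, so these supports cover \<open>U\<close>.\<close>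
  let ?S = "{f \<in> carrier R. D f \<subseteq> U}"
  let ?W = "prime_spectrum R - zariski_closed R ?S"
  have "U \<subseteq> (\<Union>f\<in>?S. D f)"
  proof
    fix x assume "x \<in> U"
    then obtain V where "quasicompact_open X V" "x \<in> V" "V \<subseteq> U"
      using quasicompact_open_basis[OF spectral U] by metis
    then show "x \<in> (\<Union>f\<in>?S. D f)" using support_surj[of V] by blast
  qed
  then have "{x \<in> topspace X. vanishing_ideal x \<in> ?W} = U"
    by (subst vanishing_ideal_preimage) auto
  moreover have "?W \<subseteq> vanishing_ideal ` topspace X" using vanishing_ideal_image by blast
  ultimately have "vanishing_ideal ` U = ?W" by blast
  then show "openin (Spec R) (vanishing_ideal ` U)"
    unfolding openin_Spec by (intro exI[of _ ?S]) auto
qed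

lemma inj_on_vanishing_ideal: "inj_on vanishing_ideal (topspace X)"
proof (rule inj_onI)
  fix x y assume xy: "x \<in> topspace X" "y \<in> topspace X" "vanishing_ideal x = vanishing_ideal y"
  show "x = y"
  proof (rule spectral_space_separated[OF spectral xy(1,2)])
    fix U assume "quasicompact_open X U"
    then obtain f where "f \<in> carrier R" "D f = U" using support_surj by blast
    then show "x \<in> U \<longleftrightarrow> y \<in> U" using xy(3) unfolding vanishing_ideal_def by blast
  qed
qed

lemma homeomorphic_space_Spec: "X homeomorphic_space Spec R"
  by (rule homeomorphic_map_imp_homeomorphic_space, rule bijective_open_imp_homeomorphic_map)
    (rule continuous_map_vanishing_ideal open_map_vanishing_ideal inj_on_vanishing_ideal
      vanishing_ideal_image[folded topspace_Spec])+

end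

section \<open>Hochster's theorem\<close>

lemma infinite_lepoll_times:
  assumes "infinite C" "A \<lesssim> C" "B \<lesssim> C"
  shows "A \<times> B \<lesssim> C"
proof -
  have "C \<times> C \<approx> C"
    unfolding eqpoll_iff_card_of_ordIso using assms(1) by (rule card_of_Times_same_infinite)
  then show ?thesis using times_lepoll_mono[OF assms(2,3)] lepoll_trans2 by blast
qed

text \<open>A family of subsets of \<open>'c\<close> indexed by \<open>'a\<close> amounts to a
  subset of \<open>'a \<times> 'c\<close>, and this product embeds into \<open>'c\<close>.\<close>

lemma lepoll_fun_set:
  assumes "infinite (UNIV :: 'c set)" "(UNIV :: 'a set) \<lesssim> (UNIV :: 'c set)"
    "(UNIV :: 'b set) \<lesssim> (UNIV :: 'c set set)"
  shows "(UNIV :: ('a \<Rightarrow> 'b) set) \<lesssim> (UNIV :: 'c set set)"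
proof -
  obtain p :: "'a \<times> 'c \<Rightarrow> 'c" where p: "inj p"
    using infinite_lepoll_times[OF assms(1,2) lepoll_refl] unfolding lepoll_def by auto
  obtain e :: "'b \<Rightarrow> 'c set" where e: "inj e"
    using assms(3) unfolding lepoll_def by auto
  have "f = g" if "{p (x, z) | x z. z \<in> e (f x)} = {p (x, z) | x z. z \<in> e (g x)}" for f g
  proof
    fix x
    have "z \<in> e (h x) \<longleftrightarrow> p (x, z) \<in> {p (x, z) | x z. z \<in> e (h x)}" for z h
      using p by (auto dest: injD)
    then have "e (f x) = e (g x)" using that by blast
    then show "f x = g x" using e by (auto dest: injD)
  qed
  then have "inj (\<lambda>f. {p (x, z) | x z. z \<in> e (f x)})" by (auto intro!: injI)
  then show ?thesis unfolding lepoll_def by blast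
qed

lemma lepoll_set: "(UNIV :: 'a set) \<lesssim> (UNIV :: 'a set set)"
  unfolding lepoll_def by (intro exI[of _ "\<lambda>x. {x}"]) (auto intro: injI)

text \<open>
  The polynomial ring is an instance of \<open>idom\<close> only for linearly ordered indeterminates, and
  sets carry no linear order; hence a copy of the type with an arbitrary well-order.
\<close>

typedef 'a well_ordered = "UNIV :: 'a set"
  by simp

instantiation well_ordered :: (type) linorder
begin

definition less_eq_well_ordered :: "'a well_ordered \<Rightarrow> 'a well_ordered \<Rightarrow> bool" where
  "less_eq_well_ordered x y \<longleftrightarrow> (x, y) \<in> (SOME r. well_order_on UNIV r)"

definition less_well_ordered :: "'a well_ordered \<Rightarrow> 'a well_ordered \<Rightarrow> bool" where
  "less_well_ordered x y \<longleftrightarrow> x \<le> y \<and> \<not> y \<le> x"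

instance
proof
  let ?r = "SOME r :: 'a well_ordered rel. well_order_on UNIV r"
  have "well_order_on UNIV ?r" using well_order_on[of UNIV] by (rule someI_ex)
  then have r: "refl ?r" "trans ?r" "antisym ?r" "total ?r"
    by (auto simp: well_order_on_def linear_order_on_def partial_order_on_def preorder_on_def)
  fix x y z :: "'a well_ordered"
  show "x < y \<longleftrightarrow> x \<le> y \<and> \<not> y \<le> x" by (rule less_well_ordered_def)
  show "x \<le> x" using r(1) by (simp add: less_eq_well_ordered_def refl_on_def)
  show "x \<le> y \<Longrightarrow> y \<le> z \<Longrightarrow> x \<le> z"
    using r(2) unfolding less_eq_well_ordered_def by (rule transD)
  show "x \<le> y \<Longrightarrow> y \<le> x \<Longrightarrow> x = y"
    using r(3) unfolding less_eq_well_ordered_def by (rule antisymD)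
  show "x \<le> y \<or> y \<le> x"
    using r(1,4) unfolding less_eq_well_ordered_def total_on_def refl_on_def by (metis UNIV_I)
qed

end

text \<open>Monomials and polynomials are bounded crudely by all functions, regardless of finite
  support. Each of the two stages costs one power set; fractions cost none, because an infinite set
  absorbs its square.\<close>

lemma lepoll_rational_function:
  assumes inf: "infinite (UNIV :: 'c set)" and v: "(UNIV :: 'v::linorder set) \<lesssim> (UNIV :: 'c set)"
  shows "(UNIV :: 'v rational_function set) \<lesssim> (UNIV :: 'c set set set)"
proof -
  let ?C = "UNIV :: 'c set set"
  have inf': "infinite ?C" using inf by (simp add: Finite_Set.finite_set)
  have inf'': "infinite (UNIV :: 'c set set set)" using inf' by (simp add: Finite_Set.finite_set)
  have nat: "(UNIV :: nat set) \<lesssim> ?C" using inf' by (simp add: infinite_le_lepoll)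
  have "(UNIV :: ('v \<Rightarrow> nat) set) \<lesssim> ?C" by (rule lepoll_fun_set[OF inf v nat])
  moreover have "(UNIV :: ('v \<Rightarrow>\<^sub>0 nat) set) \<lesssim> (UNIV :: ('v \<Rightarrow> nat) set)"
    unfolding lepoll_def by (intro exI[of _ Poly_Mapping.lookup]) (auto intro!: injI poly_mapping_eqI)
  ultimately have mon: "(UNIV :: ('v \<Rightarrow>\<^sub>0 nat) set) \<lesssim> ?C" using lepoll_trans by blast
  have "(UNIV :: int set) \<lesssim> (UNIV :: nat set)"
    unfolding lepoll_def by (intro exI[of _ int_encode]) (simp add: inj_int_encode)
  then have int: "(UNIV :: int set) \<lesssim> (UNIV :: 'c set set set)"
    using nat lepoll_set lepoll_trans by metis
  have "(UNIV :: (('v \<Rightarrow>\<^sub>0 nat) \<Rightarrow> int) set) \<lesssim> (UNIV :: 'c set set set)"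
    by (rule lepoll_fun_set[OF inf' mon int])
  moreover have "(UNIV :: (('v \<Rightarrow>\<^sub>0 nat) \<Rightarrow>\<^sub>0 int) set) \<lesssim> (UNIV :: (('v \<Rightarrow>\<^sub>0 nat) \<Rightarrow> int) set)"
    unfolding lepoll_def by (intro exI[of _ Poly_Mapping.lookup]) (auto intro!: injI poly_mapping_eqI)
  ultimately have pol: "(UNIV :: (('v \<Rightarrow>\<^sub>0 nat) \<Rightarrow>\<^sub>0 int) set) \<lesssim> (UNIV :: 'c set set set)"
    using lepoll_trans by blast
  have "(UNIV :: 'v rational_function set) \<subseteq> (\<lambda>(p, q). Fract p q) ` (UNIV \<times> UNIV)"
  proof
    fix a :: "'v rational_function"
    show "a \<in> (\<lambda>(p, q). Fract p q) ` (UNIV \<times> UNIV)" by (cases a) auto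
  qed
  then have "(UNIV :: 'v rational_function set) \<lesssim>
      (UNIV :: (('v \<Rightarrow>\<^sub>0 nat) \<Rightarrow>\<^sub>0 int) set) \<times> (UNIV :: (('v \<Rightarrow>\<^sub>0 nat) \<Rightarrow>\<^sub>0 int) set)"
    by (rule subset_image_lepoll)
  then show ?thesis using infinite_lepoll_times[OF inf'' pol pol] lepoll_trans by blast
qed

text \<open>Passing to functions on \<open>'a\<close> costs no further power set, because
  \<open>'a\<close> embeds into \<open>('a set + nat) set\<close>.\<close>

lemma function_encoding:
  obtains e :: "('a \<Rightarrow> 'a set well_ordered rational_function) \<Rightarrow> 'a ring_elem" where "inj e"
proof -
  let ?B = "UNIV :: ('a set + nat) set"
  have inf: "infinite ?B" by (simp add: finite_Plus_UNIV_iff)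
  then have inf': "infinite (UNIV :: ('a set + nat) set set)" by (simp add: Finite_Set.finite_set)
  have "inj (Inl \<circ> Rep_well_ordered :: 'a set well_ordered \<Rightarrow> 'a set + nat)"
    by (auto intro!: injI simp: Rep_well_ordered_inject)
  then have "(UNIV :: 'a set well_ordered set) \<lesssim> ?B" unfolding lepoll_def by blast
  then have K: "(UNIV :: 'a set well_ordered rational_function set) \<lesssim> (UNIV :: ('a set + nat) set set set)"
    by (rule lepoll_rational_function[OF inf])
  have "inj (\<lambda>x :: 'a. {Inl {x}} :: ('a set + nat) set)" by (auto intro!: injI)
  then have a: "(UNIV :: 'a set) \<lesssim> (UNIV :: ('a set + nat) set set)" unfolding lepoll_def by blast
  show ?thesis using lepoll_fun_set[OF inf' a K] that unfolding lepoll_def by blast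
qed

section \<open>The ring of functions and the supports of its elements\<close>

text \<open>The quasicompact open sets are the indeterminates; those not containing \<open>y\<close> vanish at \<open>y\<close>.\<close>

definition vanishing_at :: "'a \<Rightarrow> 'a set well_ordered set" where
  "vanishing_at y = {v. y \<notin> Rep_well_ordered v}"

text \<open>For points of a spectral space this is \<open>y \<in> X closure_of {x}\<close>, tested
  on a basis.\<close>

definition specializes :: "'a topology \<Rightarrow> 'a \<Rightarrow> 'a \<Rightarrow> bool" where
  "specializes X x y \<longleftrightarrow> x \<in> topspace X \<and> y \<in> topspace X \<and>
     (\<forall>U. quasicompact_open X U \<longrightarrow> y \<in> U \<longrightarrow> x \<in> U)"

text \<open>The requirement \<open>f y \<in> K y\<close> is the case \<open>x = y\<close> of the
  last condition, because \<open>reduces_to\<close> includes \<open>free_of\<close>. The value 0 off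
  \<open>topspace X\<close> makes a function determined by its restriction to the space.\<close>

definition Hochster_ring :: "'a topology \<Rightarrow> ('a \<Rightarrow> 'a set well_ordered rational_function) ring" where
  "Hochster_ring X =
    \<lparr>carrier = {f. (\<forall>x. x \<notin> topspace X \<longrightarrow> f x = 0) \<and> constructible_map X f \<and>
       (\<forall>x y. specializes X x y \<longrightarrow> reduces_to (vanishing_at y) (f x) (f y))},
     mult = (\<lambda>f g x. f x * g x), one = (\<lambda>x. if x \<in> topspace X then 1 else 0),
     zero = (\<lambda>x. 0), add = (\<lambda>f g x. f x + g x)\<rparr>"

lemma Hochster_ring_simps [simp]:
  "f \<otimes>\<^bsub>Hochster_ring X\<^esub> g = (\<lambda>x. f x * g x)"
  "f \<oplus>\<^bsub>Hochster_ring X\<^esub> g = (\<lambda>x. f x + g x)"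
  "\<zero>\<^bsub>Hochster_ring X\<^esub> = (\<lambda>x. 0)"
  "\<one>\<^bsub>Hochster_ring X\<^esub> = (\<lambda>x. if x \<in> topspace X then 1 else 0)"
  by (simp_all add: Hochster_ring_def)

lemma Hochster_ring_carrier:
  "f \<in> carrier (Hochster_ring X) \<longleftrightarrow> (\<forall>x. x \<notin> topspace X \<longrightarrow> f x = 0) \<and> constructible_map X f \<and>
       (\<forall>x y. specializes X x y \<longrightarrow> reduces_to (vanishing_at y) (f x) (f y))"
  by (simp add: Hochster_ring_def)

text \<open>An open set is stable under generization, so along a specialization the value can only
  change from \<open>a\<close> to 0.\<close>

lemma Hochster_ring_indicator:
  assumes "spectral_space X" "quasicompact_open X U"
    and "\<And>y. y \<in> U \<Longrightarrow> reduces_to (vanishing_at y) a a"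
    and "\<And>y. y \<in> topspace X \<Longrightarrow> y \<notin> U \<Longrightarrow> U = topspace X \<or> reduces_to (vanishing_at y) a 0"
  shows "(\<lambda>x. if x \<in> U then a else 0) \<in> carrier (Hochster_ring X)"
  unfolding Hochster_ring_carrier
proof (intro conjI allI impI)
  show "(if x \<in> U then a else 0) = 0" if "x \<notin> topspace X" for x
    using that quasicompact_open_subset[OF assms(2)] by auto
  show "constructible_map X (\<lambda>x. if x \<in> U then a else 0)"
    by (rule constructible_map_indicator[OF assms(1,2)])
  show "reduces_to (vanishing_at y) (if x \<in> U then a else 0) (if y \<in> U then a else 0)"
    if "specializes X x y" for x y
    using that assms(2-4) unfolding specializes_def by auto
qed

lemma Hochster_ring_of_nat:
  "spectral_space X \<Longrightarrow> (\<lambda>x. if x \<in> topspace X then of_nat n else 0) \<in> carrier (Hochster_ring X)"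
  by (rule Hochster_ring_indicator) (auto intro: quasicompact_open_topspace reduces_to_of_nat)

text \<open>One closure principle serves the ring operations and also the quotient
  \<open>f ^ n / g\<close>.\<close>

lemma Hochster_ring_closed:
  assumes "spectral_space X" "f \<in> carrier (Hochster_ring X)" "g \<in> carrier (Hochster_ring X)"
    and "h 0 0 = 0"
    and "\<And>x y. specializes X x y \<Longrightarrow> reduces_to (vanishing_at y) (f x) (f y) \<Longrightarrow>
      reduces_to (vanishing_at y) (g x) (g y) \<Longrightarrow>
      reduces_to (vanishing_at y) (h (f x) (g x)) (h (f y) (g y))"
  shows "(\<lambda>x. h (f x) (g x)) \<in> carrier (Hochster_ring X)"
  unfolding Hochster_ring_carrier
proof (intro conjI allI impI)
  show "h (f x) (g x) = 0" if "x \<notin> topspace X" for x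
    using that assms(2-4) by (simp add: Hochster_ring_carrier)
  show "constructible_map X (\<lambda>x. h (f x) (g x))"
    by (rule constructible_map_combine[OF assms(1)]) (use assms(2,3) in \<open>simp_all add: Hochster_ring_carrier\<close>)
  show "reduces_to (vanishing_at y) (h (f x) (g x)) (h (f y) (g y))" if "specializes X x y" for x y
    by (rule assms(5)) (use that assms(2,3) in \<open>simp_all add: Hochster_ring_carrier\<close>)
qed

lemma Hochster_ring_cring:
  assumes X: "spectral_space X"
  shows "cring (Hochster_ring X)"
proof -
  note closed = Hochster_ring_closed[OF X]
  show ?thesis
  proof (rule cringI)
    show "abelian_group (Hochster_ring X)"
    proof (rule abelian_groupI)
      fix f g assume fg: "f \<in> carrier (Hochster_ring X)" "g \<in> carrier (Hochster_ring X)"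
      show "f \<oplus>\<^bsub>Hochster_ring X\<^esub> g \<in> carrier (Hochster_ring X)"
        using closed[OF fg, of "(+)"] by (simp add: reduces_to_add)
    next
      fix f assume f: "f \<in> carrier (Hochster_ring X)"
      show "\<exists>g\<in>carrier (Hochster_ring X). g \<oplus>\<^bsub>Hochster_ring X\<^esub> f = \<zero>\<^bsub>Hochster_ring X\<^esub>"
        using closed[OF f f, of "\<lambda>a b. - a"]
        by (intro bexI[of _ "\<lambda>x. - f x"]) (simp_all add: reduces_to_uminus)
    next
      show "\<zero>\<^bsub>Hochster_ring X\<^esub> \<in> carrier (Hochster_ring X)"
        using Hochster_ring_of_nat[OF X, of 0] by (simp cong: if_cong)
    qed (auto simp: algebra_simps)
    show "Group.comm_monoid (Hochster_ring X)"
    proof (rule comm_monoidI)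
      fix f g assume fg: "f \<in> carrier (Hochster_ring X)" "g \<in> carrier (Hochster_ring X)"
      show "f \<otimes>\<^bsub>Hochster_ring X\<^esub> g \<in> carrier (Hochster_ring X)"
        using closed[OF fg, of "(*)"] by (simp add: reduces_to_mult)
    next
      show "\<one>\<^bsub>Hochster_ring X\<^esub> \<in> carrier (Hochster_ring X)"
        using Hochster_ring_of_nat[OF X, of 1] by (simp cong: if_cong)
    next
      fix f assume "f \<in> carrier (Hochster_ring X)"
      then show "\<one>\<^bsub>Hochster_ring X\<^esub> \<otimes>\<^bsub>Hochster_ring X\<^esub> f = f"
        by (auto simp: Hochster_ring_carrier)
    qed (auto simp: algebra_simps)
  qed (auto simp: algebra_simps)
qed

text \<open>Off \<open>topspace X\<close> the unit of the ring is 0 whereas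
  \<open>f x ^ 0 = 1\<close>, hence the positive exponent.\<close>

lemma Hochster_ring_power:
  assumes "\<And>x. x \<notin> topspace X \<Longrightarrow> f x = 0" "n > 0"
  shows "f [^]\<^bsub>Hochster_ring X\<^esub> (n::nat) = (\<lambda>x. f x ^ n)"
  using assms(2)
proof (induction n)
  case (Suc n)
  then show ?case using assms(1)
    by (cases "n = 0") (auto simp: nat_pow_def fun_eq_iff Hochster_ring_def)
qed simp

definition nonzero_locus :: "'a topology \<Rightarrow> ('a \<Rightarrow> 'b::zero) \<Rightarrow> 'a set" where
  "nonzero_locus X f = {x \<in> topspace X. f x \<noteq> 0}"

text \<open>Nonvanishing passes to generizations by \<open>reduces_to_nonzero\<close>.\<close>

lemma quasicompact_open_nonzero_locus:
  assumes X: "spectral_space X" and f: "f \<in> carrier (Hochster_ring X)"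
  shows "quasicompact_open X (nonzero_locus X f)"
proof (rule constructible_generization_stable[OF X])
  have "constructible X {x \<in> topspace X. f x \<in> - {0}}"
    using f unfolding Hochster_ring_carrier constructible_map_def by blast
  then show "constructible X (nonzero_locus X f)" by (simp add: nonzero_locus_def)
  show "x \<in> nonzero_locus X f" if "y \<in> nonzero_locus X f" "x \<in> topspace X"
    "\<And>U. quasicompact_open X U \<Longrightarrow> y \<in> U \<Longrightarrow> x \<in> U" for x y
  proof -
    have "specializes X x y" using that by (auto simp: specializes_def nonzero_locus_def)
    then have "reduces_to (vanishing_at y) (f x) (f y)" using f by (simp add: Hochster_ring_carrier)
    then have "f x \<noteq> 0" by (rule reduces_to_nonzero) (use that in \<open>simp add: nonzero_locus_def\<close>)
    then show ?thesis using that by (simp add: nonzero_locus_def)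
  qed
qed

text \<open>Let \<open>x\<close> specialize to \<open>y\<close>. If \<open>g y \<noteq> 0\<close>,
  inverses reduce to inverses. If \<open>g y = 0\<close>, then \<open>f y = 0\<close>, and
  \<open>f x ^ n / g x\<close> has positive order for large \<open>n\<close>; the finitely many
  values of \<open>g\<close> allow a common \<open>n\<close>.\<close>

lemma Hochster_ring_divides:
  assumes X: "spectral_space X"
    and f: "f \<in> carrier (Hochster_ring X)" and g: "g \<in> carrier (Hochster_ring X)"
    and sub: "nonzero_locus X f \<subseteq> nonzero_locus X g"
  shows "\<exists>n::nat. \<exists>h\<in>carrier (Hochster_ring X). f [^]\<^bsub>Hochster_ring X\<^esub> n = g \<otimes>\<^bsub>Hochster_ring X\<^esub> h"
proof -
  have "\<forall>b :: 'a set well_ordered rational_function.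
      \<exists>N. \<forall>S a n. reduces_to S a 0 \<longrightarrow> N \<le> n \<longrightarrow> reduces_to S (a ^ n / b) 0"
    using reduces_to_zero_power_divide by metis
  from choice[OF this] obtain N :: "'a set well_ordered rational_function \<Rightarrow> nat"
    where N: "\<And>b S a n. reduces_to S a 0 \<Longrightarrow> N b \<le> n \<Longrightarrow> reduces_to S (a ^ n / b) 0" by blast
  \<comment> \<open>\<open>insert 0\<close> keeps \<open>Max\<close> meaningful on the empty space;
    \<open>Suc\<close> makes the exponent positive, so that \<open>f x ^ n\<close> vanishes with
    \<open>f x\<close>.\<close>
  define n where "n = Suc (Max (insert 0 (N ` g ` topspace X)))"
  have "finite (g ` topspace X)" using g by (simp add: Hochster_ring_carrier constructible_map_def)
  then have n: "N (g x) \<le> n" if "x \<in> topspace X" for x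
    unfolding n_def using that by (intro le_SucI Max_ge) auto
  \<comment> \<open>\<open>x / 0 = 0\<close> extends the quotient by zero.\<close>
  have "(\<lambda>x. f x ^ n / g x) \<in> carrier (Hochster_ring X)"
  proof (rule Hochster_ring_closed[OF X f g])
    show "0 ^ n / 0 = (0 :: 'a set well_ordered rational_function)" by simp
    fix x y assume xy: "specializes X x y"
      and rf: "reduces_to (vanishing_at y) (f x) (f y)" and rg: "reduces_to (vanishing_at y) (g x) (g y)"
    show "reduces_to (vanishing_at y) (f x ^ n / g x) (f y ^ n / g y)"
    proof (cases "g y = 0")
      case True
      then have "f y = 0" using sub xy by (auto simp: nonzero_locus_def specializes_def)
      then show ?thesis using N[OF _ n, of _ "f x" x] rf xy True by (simp add: specializes_def)
    next
      case False
      show ?thesis unfolding divide_inverse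
        by (intro reduces_to_mult reduces_to_power rf reduces_to_nonzero(2)[OF rg False])
    qed
  qed
  moreover have "f [^]\<^bsub>Hochster_ring X\<^esub> n = (\<lambda>x. f x ^ n)"
    using f by (intro Hochster_ring_power) (auto simp: Hochster_ring_carrier n_def)
  moreover have "f x = 0" if "g x = 0" for x
    using that sub f by (cases "x \<in> topspace X") (auto simp: nonzero_locus_def Hochster_ring_carrier)
  then have "f x ^ n = g x * (f x ^ n / g x)" for x by (cases "g x = 0") (simp_all add: n_def)
  then have "(\<lambda>x. f x ^ n) = (\<lambda>x. g x * (f x ^ n / g x))" by blast
  ultimately show ?thesis
    by (intro exI[of _ n] bexI[of _ "\<lambda>x. f x ^ n / g x"]) (simp_all only: Hochster_ring_simps)
qed

text \<open>Where \<open>g\<close> is nonzero, \<open>f + c g\<close> vanishes only if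
  \<open>c = - (f / g)\<close>. This quotient takes finitely many values, so some natural number
  avoids them all; elsewhere the sum equals \<open>f\<close>.\<close>

lemma Hochster_ring_join:
  assumes X: "spectral_space X"
    and f: "f \<in> carrier (Hochster_ring X)" and g: "g \<in> carrier (Hochster_ring X)"
  shows "\<exists>c\<in>carrier (Hochster_ring X).
    nonzero_locus X (f \<oplus>\<^bsub>Hochster_ring X\<^esub> c \<otimes>\<^bsub>Hochster_ring X\<^esub> g) = nonzero_locus X f \<union> nonzero_locus X g"
proof -
  have fin: "finite ((\<lambda>x. - (f x / g x)) ` topspace X)"
    using constructible_map_combine[OF X, of f g "\<lambda>a b. - (a / b)"] f g
    by (simp add: Hochster_ring_carrier constructible_map_def)
  have "infinite (range (of_nat :: nat \<Rightarrow> 'a set well_ordered rational_function))"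
    by (rule range_inj_infinite[OF inj_of_nat_fract])
  then obtain c where c: "c \<in> range (of_nat :: nat \<Rightarrow> 'a set well_ordered rational_function)"
      "c \<notin> insert 0 ((\<lambda>x. - (f x / g x)) ` topspace X)"
    using fin by (meson finite_insert finite_subset subsetI)
  then obtain k where k: "c = of_nat k" by blast
  have "f x + c * g x \<noteq> 0 \<longleftrightarrow> f x \<noteq> 0 \<or> g x \<noteq> 0" if "x \<in> topspace X" for x
  proof (cases "g x = 0")
    case False
    have "c \<noteq> - (f x / g x)" using c that by blast
    then show ?thesis using False by (simp add: field_simps eq_neg_iff_add_eq_0)
  qed simp
  then have "nonzero_locus X (f \<oplus>\<^bsub>Hochster_ring X\<^esub> (\<lambda>x. if x \<in> topspace X then of_nat k else 0) \<otimes>\<^bsub>Hochster_ring X\<^esub> g) =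
      nonzero_locus X f \<union> nonzero_locus X g"
    by (auto simp: nonzero_locus_def k)
  then show ?thesis using Hochster_ring_of_nat[OF X] by blast
qed

text \<open>The indeterminate of \<open>U\<close> is free of \<open>vanishing_at y\<close> for
  \<open>y \<in> U\<close> and reduces to 0 for every other \<open>y\<close>.\<close>

lemma nonzero_locus_surj:
  assumes X: "spectral_space X" and U: "quasicompact_open X U"
  shows "\<exists>f\<in>carrier (Hochster_ring X). nonzero_locus X f = U"
proof
  let ?v = "Abs_well_ordered U"
  have v: "?v \<in> vanishing_at y \<longleftrightarrow> y \<notin> U" for y
    by (simp add: vanishing_at_def Abs_well_ordered_inverse)
  show "(\<lambda>x. if x \<in> U then indeterminate ?v else 0) \<in> carrier (Hochster_ring X)"
    by (rule Hochster_ring_indicator[OF X U]) (simp_all add: reduces_to_indeterminate v)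
  show "nonzero_locus X (\<lambda>x. if x \<in> U then indeterminate ?v else 0) = U"
    using quasicompact_open_subset[OF U] by (auto simp: nonzero_locus_def)
qed

theorem theorem3p4:
  fixes X :: "'a topology"
  assumes "spectral_space X"
  shows "\<exists>R :: 'a ring_elem ring. cring R \<and> X homeomorphic_space Spec R"
proof -
  let ?H = "Hochster_ring X"
  have H: "cring ?H" by (rule Hochster_ring_cring[OF assms])
  note ring_H = cring.axioms(1)[OF H]
  obtain e :: "('a \<Rightarrow> 'a set well_ordered rational_function) \<Rightarrow> 'a ring_elem" where e: "inj e"
    by (rule function_encoding)
  \<comment> \<open>The ring of functions is transported along the injection \<open>e\<close> to the
    element type required by the theorem, and supports are read off through its inverse.\<close>
  define R where "R = image_ring e ?H"
  define D where "D r = nonzero_locus X (inv_into UNIV e r)" for r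
  have iso: "e \<in> ring_iso ?H R"
    unfolding R_def by (rule inj_imp_image_ring_iso) (use e in \<open>auto intro: inj_on_subset\<close>)
  then have hom: "e \<in> ring_hom ?H R" by (simp add: ring_iso_def)
  have D_e: "D (e f) = nonzero_locus X f" for f using e by (simp add: D_def)
  have carrier: "carrier R = e ` carrier ?H" using iso by (auto simp: ring_iso_def bij_betw_def)
  have R: "cring R"
    using cring.ring_iso_imp_img_cring[OF H iso] by (simp add: R_def image_ring_def image_group_def monoid.defs)
  have zero: "\<zero>\<^bsub>R\<^esub> = e \<zero>\<^bsub>?H\<^esub>"
    using ring_hom_zero[OF hom ring_H cring.axioms(1)[OF R]] by simp
  have power: "e f [^]\<^bsub>R\<^esub> n = e (f [^]\<^bsub>?H\<^esub> n)" if "f \<in> carrier ?H" for f and n :: nat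
    by (induction n) (use that hom monoid.nat_pow_closed[OF ring.is_monoid[OF ring_H] that]
      in \<open>simp_all add: ring_hom_one ring_hom_mult monoid.nat_pow_0 monoid.nat_pow_Suc
        ring.is_monoid[OF ring_H] ring.is_monoid[OF cring.axioms(1)[OF R]] del: Hochster_ring_simps\<close>)
  have "spectral_support R X D"
  proof (intro spectral_support.intro spectral_support_axioms.intro R assms)
    show "quasicompact_open X (D r)" if "r \<in> carrier R" for r
      using that quasicompact_open_nonzero_locus[OF assms] by (auto simp: carrier D_e)
    show "\<exists>r\<in>carrier R. D r = U" if "quasicompact_open X U" for U
      using nonzero_locus_surj[OF assms that] by (auto simp: carrier D_e)
    show "D \<zero>\<^bsub>R\<^esub> = {}" unfolding zero D_e by (simp add: nonzero_locus_def)
    show "D \<one>\<^bsub>R\<^esub> = topspace X"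
      unfolding ring_hom_one[OF hom, symmetric] D_e by (simp add: nonzero_locus_def)
    fix r s assume "r \<in> carrier R" "s \<in> carrier R"
    then obtain f g where f: "f \<in> carrier ?H" "r = e f" and g: "g \<in> carrier ?H" "s = e g"
      by (auto simp: carrier)
    note hom_simps = f(2) g(2) ring_hom_mult[OF hom, symmetric] ring_hom_add[OF hom, symmetric]
    show "D (r \<otimes>\<^bsub>R\<^esub> s) = D r \<inter> D s"
      using f(1) g(1) by (simp add: hom_simps D_e) (auto simp: nonzero_locus_def)
    show "D (r \<oplus>\<^bsub>R\<^esub> s) \<subseteq> D r \<union> D s"
      using f(1) g(1) by (simp add: hom_simps D_e) (auto simp: nonzero_locus_def)
    show "\<exists>c\<in>carrier R. D (r \<oplus>\<^bsub>R\<^esub> c \<otimes>\<^bsub>R\<^esub> s) = D r \<union> D s"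
    proof -
      obtain c where "c \<in> carrier ?H"
        "nonzero_locus X (f \<oplus>\<^bsub>?H\<^esub> c \<otimes>\<^bsub>?H\<^esub> g) = nonzero_locus X f \<union> nonzero_locus X g"
        using Hochster_ring_join[OF assms f(1) g(1)] by blast
      then show ?thesis using f(1) g(1) monoid.m_closed[OF ring.is_monoid[OF ring_H], of c g] unfolding carrier
        by (intro bexI[of _ "e c"]) (simp_all add: hom_simps D_e del: Hochster_ring_simps)
    qed
    show "\<exists>n::nat. \<exists>h\<in>carrier R. r [^]\<^bsub>R\<^esub> n = s \<otimes>\<^bsub>R\<^esub> h" if "D r \<subseteq> D s"
    proof -
      have "nonzero_locus X f \<subseteq> nonzero_locus X g" using that by (simp add: f g D_e)
      then obtain n :: nat and h where h: "h \<in> carrier ?H" "f [^]\<^bsub>?H\<^esub> n = g \<otimes>\<^bsub>?H\<^esub> h"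
        using Hochster_ring_divides[OF assms f(1) g(1)] by blast
      then have "r [^]\<^bsub>R\<^esub> n = s \<otimes>\<^bsub>R\<^esub> e h"
        using f g power[OF f(1), of n] ring_hom_mult[OF hom g(1) h(1)] by simp
      then show ?thesis using h(1) by (auto simp: carrier)
    qed
  qed
  then have "X homeomorphic_space Spec R" by (rule spectral_support.homeomorphic_space_Spec)
  then show ?thesis using R by blast
qed

end
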